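(* Let $a\in\mathbb R$ with $a^2>2$. The matrix polynomials $\mathcal P_n$, $n=0,2,3,\dots$, defined in the context, are orthogonal with respect to the weight matrix $\mathcal W_a(t)\,dt$ on $\mathbb R$, where $$\mathcal W_a(t)=\frac{e^{-t^2}}{\mathfrak p^2(t)}\begin{pmatrix}\frac{a^2}{4(a^2-2)}\mathfrak p(t)^2+\frac{\mathfrak p(t)}{a^2-2}-a^2 & a\left(\frac{\mathfrak p(t)}{a^2-2}-2\right)t\\ a\left(\frac{\mathfrak p(t)}{a^2-2}-2\right)t& \frac{2(a^2(a^2-2)-\mathfrak p(t))}{(a^2-2)^2}\end{pmatrix},\qquad \mathfrak p(t)=2(2-a^2)t^2-a^2,$$ and their norm is given by $$\Vert\mathcal P_n\Vert^2_{\mathcal W_a}=\frac{n-1}{2(a^2-2)}\begin{pmatrix}1&0\\ 0&-\frac{2}{a^2-2}\end{pmatrix}\Vert P_n\Vert^2_{W_{a,\xi(a)}},$$ where $\xi(a)=1-a^2$ and $$\Vert P_n\Vert^2_{W_{a,\xi(a)}}=\sqrt\pi\,2^nn!\begin{pmatrix}\xi(a)+a^2(n+1)/2&0\\ 0&\xi(a)(\xi(a)+a^2n/2)\end{pmatrix}.$$ Moreover, their linear combinations are dense in $L^2(\mathcal W_a)$.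
   Context: Let $H_n$ be the Hermite polynomials $H_n(t)=(-1)^ne^{t^2}\frac{d^n}{dt^n}e^{-t^2}$ and $\xi(a)=1-a^2$. For $n\ge0$ put $$P_n(t)=H_n(t)\begin{pmatrix}1&0\\ 0&\xi(a)\end{pmatrix}+nH_{n-1}(t)\begin{pmatrix}0&-a\\ -a&a^2t\end{pmatrix};$$ in particular $P_1(t)=\begin{pmatrix}2t&-a\\ -a&t(2-a^2)\end{pmatrix}$, with $\det P_1=\mathfrak p$. (These are orthogonal with respect to the signed weight $W_{a,\xi(a)}(t)=e^{-t^2}\begin{pmatrix}1&at\\ 0&1\end{pmatrix}\begin{pmatrix}\xi(a)&0\\ 0&1\end{pmatrix}\begin{pmatrix}1&0\\ at&1\end{pmatrix}$, and $\Vert P_n\Vert^2_{W_{a,\xi(a)}}=\int P_nW_{a,\xi(a)}P_n^*\,dt$ is given by the formula in the statement.) Define $$\mathcal P_n=-P_n+P_n'\,(P_1')^{-1}P_1,\qquad n\ge0 ,$$ where $P_1'$ is the (constant, invertible) derivative of $P_1$; thus $\mathcal P_1=0$. Orthogonality: $\int_{\mathbb R}\mathcal P_n\mathcal W_a\mathcal P_m^*\,dt=0$ for $n\ne m$; $\Vert\mathcal P_n\Vert^2_{\mathcal W_a}=\int_{\mathbb R}\mathcal P_n\mathcal W_a\mathcal P_n^*\,dt$ (a $2\times2$ matrix); $*$ is (conjugate) transpose. A weight matrix is a positive definite matrix of measures with finite moments of every order. $L^2(\mathcal W_a)$ is the space of $2\times2$ matrix functions $f$ with $\int\operatorname{tr}(f\mathcal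 W_af^* )\,dt<\infty$ (modulo null functions), and linear combinations of the $\mathcal P_n$ are finite sums $\sum C_n\mathcal P_n$ with constant $2\times2$ matrix coefficients $C_n$ on the left. *)

theory Defs
  imports "HOL-Analysis.Analysis"
begin

text \<open>
  All matrices live in \<^typ>\<open>complex^2^2\<close>, so that \<open>*\<close> is the conjugate transpose and
  \<open>L\<^sup>2\<close> and the coefficients of linear combinations are complex. The concrete matrices
  have real entries, which \<open>mat22\<close> embeds into the complex numbers.
\<close>

definition mat22 :: "real \<Rightarrow> real \<Rightarrow> real \<Rightarrow> real \<Rightarrow> complex^2^2" where
  "mat22 p q r s = vector [vector [of_real p, of_real q], vector [of_real r, of_real s]]"

definition ctranspose :: "complex^2^2 \<Rightarrow> complex^2^2" where
  "ctranspose A = (\<chi> i j. cnj (A $ j $ i))"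

definition positive_definite :: "complex^2^2 \<Rightarrow> bool" where
  "positive_definite A \<longleftrightarrow>
     ctranspose A = A \<and> (\<forall>v. v \<noteq> 0 \<longrightarrow> 0 < Re (\<Sum>i\<in>UNIV. cnj (v $ i) * (A *v v) $ i))"

text \<open>
  A function \<open>W\<close> stands for the matrix of measures \<open>W(t) dt\<close>, whose value on a Borel set \<open>A\<close>
  is the integral of \<open>W\<close> over \<open>A\<close>; positive definiteness of such a matrix of measures is
  positive definiteness of its density almost everywhere. The moment of order \<open>0\<close> accounts for
  measurability and integrability of \<open>W\<close> itself.
\<close>

definition weight_matrix :: "(real \<Rightarrow> complex^2^2) \<Rightarrow> bool" where
  "weight_matrix W \<longleftrightarrow>
     (AE t in lborel. positive_definite (W t)) \<and>
     (\<forall>k::nat. integrable lborel (\<lambda>t. (t ^ k) *\<^sub>R W t))"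

text \<open>
  Stating the value of a matrix inner product by \<^const>\<open>has_bochner_integral\<close> includes the
  convergence of the integral; the function \<^const>\<open>lebesgue_integral\<close> is \<open>0\<close> on functions that
  are not integrable.
\<close>

definition has_matrix_inner ::
    "(real \<Rightarrow> complex^2^2) \<Rightarrow> (real \<Rightarrow> complex^2^2) \<Rightarrow> (real \<Rightarrow> complex^2^2) \<Rightarrow> complex^2^2 \<Rightarrow> bool" where
  "has_matrix_inner W F G M \<longleftrightarrow>
     has_bochner_integral lborel (\<lambda>t. F t ** W t ** ctranspose (G t)) M"

definition norm_sq :: "(real \<Rightarrow> complex^2^2) \<Rightarrow> (real \<Rightarrow> complex^2^2) \<Rightarrow> complex^2^2" where
  "norm_sq W F = (LINT t|lborel. F t ** W t ** ctranspose (F t))"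

definition orthogonal_family ::
    "(real \<Rightarrow> complex^2^2) \<Rightarrow> nat set \<Rightarrow> (nat \<Rightarrow> real \<Rightarrow> complex^2^2) \<Rightarrow> bool" where
  "orthogonal_family W I F \<longleftrightarrow>
     (\<forall>n\<in>I. \<forall>m\<in>I. n \<noteq> m \<longrightarrow> has_matrix_inner W (F n) (F m) 0)"

text \<open>
  For positive definite \<open>W t\<close> the trace below is real and nonnegative. Functions are not
  identified modulo null functions: \<open>L2_norm W\<close> is a seminorm on \<open>L2 W\<close>, which gives the same
  notion of density.
\<close>

definition L2 :: "(real \<Rightarrow> complex^2^2) \<Rightarrow> (real \<Rightarrow> complex^2^2) set" where
  "L2 W = {f. f \<in> borel_measurable lborel \<and>
     integrable lborel (\<lambda>t. Re (trace (f t ** W t ** ctranspose (f t))))}"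

definition L2_norm :: "(real \<Rightarrow> complex^2^2) \<Rightarrow> (real \<Rightarrow> complex^2^2) \<Rightarrow> real" where
  "L2_norm W f = sqrt (LINT t|lborel. Re (trace (f t ** W t ** ctranspose (f t))))"

definition L2_dense :: "(real \<Rightarrow> complex^2^2) \<Rightarrow> (real \<Rightarrow> complex^2^2) set \<Rightarrow> bool" where
  "L2_dense W S \<longleftrightarrow>
     S \<subseteq> L2 W \<and> (\<forall>f\<in>L2 W. \<forall>\<epsilon>>0. \<exists>g\<in>S. L2_norm W (\<lambda>t. f t - g t) < \<epsilon>)"

definition left_combinations ::
    "nat set \<Rightarrow> (nat \<Rightarrow> real \<Rightarrow> complex^2^2) \<Rightarrow> (real \<Rightarrow> complex^2^2) set" where
  "left_combinations I F =
     {g. \<exists>J (C :: nat \<Rightarrow> complex^2^2). finite J \<and> J \<subseteq> I \<and> g = (\<lambda>t. \<Sum>n\<in>J. C n ** F n t)}"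

definition hermite :: "nat \<Rightarrow> real \<Rightarrow> real" where
  "hermite n t = (-1) ^ n * exp (t\<^sup>2) * (deriv ^^ n) (\<lambda>s. exp (- (s\<^sup>2))) t"

definition xi :: "real \<Rightarrow> real" where
  "xi a = 1 - a\<^sup>2"

text \<open>For \<open>n = 0\<close> the truncated index \<open>n - 1\<close> is harmless, since the second term vanishes.\<close>

definition hermite_P :: "real \<Rightarrow> nat \<Rightarrow> real \<Rightarrow> complex^2^2" where
  "hermite_P a n t = hermite n t *\<^sub>R mat22 1 0 0 (xi a)
     + (real n * hermite (n - 1) t) *\<^sub>R mat22 0 (- a) (- a) (a\<^sup>2 * t)"

definition signed_weight :: "real \<Rightarrow> real \<Rightarrow> real \<Rightarrow> complex^2^2" where
  "signed_weight a c t =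
     exp (- (t\<^sup>2)) *\<^sub>R (mat22 1 (a * t) 0 1 ** mat22 c 0 0 1 ** mat22 1 0 (a * t) 1)"

definition exc_P :: "real \<Rightarrow> nat \<Rightarrow> real \<Rightarrow> complex^2^2" where
  "exc_P a n t = - hermite_P a n t
     + vector_derivative (hermite_P a n) (at t) ** matrix_inv (vector_derivative (hermite_P a 1) (at t)) ** hermite_P a 1 t"

definition pfun :: "real \<Rightarrow> real \<Rightarrow> real" where
  "pfun a t = 2 * (2 - a\<^sup>2) * t\<^sup>2 - a\<^sup>2"

definition exc_W :: "real \<Rightarrow> real \<Rightarrow> complex^2^2" where
  "exc_W a t = (exp (- (t\<^sup>2)) / (pfun a t)\<^sup>2) *\<^sub>R
     mat22 (a\<^sup>2 / (4 * (a\<^sup>2 - 2)) * (pfun a t)\<^sup>2 + pfun a t / (a\<^sup>2 - 2) - a\<^sup>2)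
           (a * (pfun a t / (a\<^sup>2 - 2) - 2) * t)
           (a * (pfun a t / (a\<^sup>2 - 2) - 2) * t)
           (2 * (a\<^sup>2 * (a\<^sup>2 - 2) - pfun a t) / (a\<^sup>2 - 2)\<^sup>2)"

end

theory Submission
  imports Defs "HOL-Probability.Distributions" "HOL-Computational_Algebra.Polynomial"
begin

text \<open>
  Put \<open>X = (P\<^sub>1')\<^sup>-\<^sup>1 P\<^sub>1\<close>, so that \<open>X' = 1\<close>, the determinant of \<open>X\<close> is a multiple of \<open>\<pp>\<close>, and the
  exceptional polynomials are \<open>R\<^sub>n = - P\<^sub>n + P\<^sub>n' X\<close>. Write \<open>\<W>\<close> for the exceptional weight and \<open>W\<close>
  for the signed one.
  The adjoint first-order operator takes the \<open>R\<^sub>m\<close> back to the \<open>P\<^sub>m\<close>, that is,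
  \<open>(X \<W> R\<^sub>m\<^sup>*)' + \<W> R\<^sub>m\<^sup>* = - W P\<^sub>m\<^sup>* \<Lambda>\<^sub>m\<close> with a constant diagonal matrix \<open>\<Lambda>\<^sub>m\<close>, so integrating by parts
  reduces orthogonality and norms to those of the \<open>P\<^sub>n\<close>, which follow from those of the
  Hermite polynomials.

  For density, a matrix polynomial \<open>R\<close> with \<open>R' = Q\<^sub>1' X\<close> for a matrix polynomial \<open>Q\<^sub>1\<close> equals \<open>- Q + Q' X\<close>
  for \<open>Q = Q\<^sub>1 X - R\<close>, and \<open>Q\<close> is a left combination of the \<open>P\<^sub>n\<close>. This covers all multiples of \<open>\<pp>\<^sup>2\<close>, and
  since \<open>\<pp>\<^sup>4 \<W>\<close> is bounded by a multiple of \<open>exp (- t\<^sup>2 / 2)\<close>, it is enough that polynomials approximate bounded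
  measurable functions in Gaussian mean square. There, trigonometric polynomials approximate bounded
  continuous functions, and their Taylor series converge.
\<close>

section \<open>Functions of polynomial growth against a Gaussian\<close>

text \<open>The base \<open>1 + t\<^sup>2\<close> is at least 1, so bounds with different exponents
  are comparable. Continuity belongs to the notion because measurability and the fundamental theorem
  of calculus are drawn from it.\<close>

definition poly_growth :: "(real \<Rightarrow> real) \<Rightarrow> bool" where
  "poly_growth f \<longleftrightarrow> continuous_on UNIV f \<and> (\<exists>C n. \<forall>t. \<bar>f t\<bar> \<le> C * (1 + t\<^sup>2) ^ n)"

lemma poly_growthE:
  assumes "poly_growth f"
  obtains C n where "C \<ge> 0" "\<And>t. \<bar>f t\<bar> \<le> C * (1 + t\<^sup>2) ^ n"
proof -
  obtain C n where C: "\<And>t. \<bar>f t\<bar> \<le> C * (1 + t\<^sup>2) ^ n"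
    using assms by (auto simp: poly_growth_def)
  from C[of 0] have "C \<ge> 0" by simp
  with C show ?thesis using that by blast
qed

lemma poly_growth_continuous: "poly_growth f \<Longrightarrow> continuous_on A f"
  unfolding poly_growth_def using continuous_on_subset by blast

lemma poly_growth_measurable: "poly_growth f \<Longrightarrow> f \<in> borel_measurable borel"
  by (intro borel_measurable_continuous_onI poly_growth_continuous)

named_theorems poly_growth_intros

lemma poly_growth_const [poly_growth_intros]: "poly_growth (\<lambda>t. c)"
  unfolding poly_growth_def
  by (intro conjI continuous_intros exI[of _ "\<bar>c\<bar>"] exI[of _ 0]) simp

lemma poly_growth_ident [poly_growth_intros]: "poly_growth (\<lambda>t. t)"
  unfolding poly_growth_def
proof (intro conjI continuous_intros exI[of _ 1] exI[of _ 1] allI)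
  fix t :: real
  have "0 \<le> (\<bar>t\<bar> - 1)\<^sup>2" by simp
  then have "\<bar>t\<bar> * 2 \<le> 1 + t\<^sup>2" by (simp add: power2_eq_square algebra_simps abs_if split: if_splits)
  then show "\<bar>t\<bar> \<le> 1 * (1 + t\<^sup>2) ^ 1" by simp
qed

lemma poly_growth_add [poly_growth_intros]:
  assumes "poly_growth f" "poly_growth g"
  shows "poly_growth (\<lambda>t. f t + g t)"
proof -
  obtain C n where f: "C \<ge> 0" "\<And>t. \<bar>f t\<bar> \<le> C * (1 + t\<^sup>2) ^ n" using poly_growthE assms(1) by blast
  obtain D m where g: "D \<ge> 0" "\<And>t. \<bar>g t\<bar> \<le> D * (1 + t\<^sup>2) ^ m" using poly_growthE assms(2) by blast
  have "\<bar>f t + g t\<bar> \<le> (C + D) * (1 + t\<^sup>2) ^ (n + m)" for t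
  proof -
    have "C * (1 + t\<^sup>2) ^ n \<le> C * (1 + t\<^sup>2) ^ (n + m)" "D * (1 + t\<^sup>2) ^ m \<le> D * (1 + t\<^sup>2) ^ (n + m)"
      by (intro mult_left_mono power_increasing f(1) g(1); simp)+
    with f(2)[of t] g(2)[of t] show ?thesis by (simp add: algebra_simps)
  qed
  then show ?thesis
    using assms unfolding poly_growth_def by (blast intro: continuous_intros)
qed

lemma poly_growth_mult [poly_growth_intros]:
  assumes "poly_growth f" "poly_growth g"
  shows "poly_growth (\<lambda>t. f t * g t)"
proof -
  obtain C n where f: "C \<ge> 0" "\<And>t. \<bar>f t\<bar> \<le> C * (1 + t\<^sup>2) ^ n" using poly_growthE assms(1) by blast
  obtain D m where g: "D \<ge> 0" "\<And>t. \<bar>g t\<bar> \<le> D * (1 + t\<^sup>2) ^ m" using poly_growthE assms(2) by blast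
  have "\<bar>f t * g t\<bar> \<le> (C * D) * (1 + t\<^sup>2) ^ (n + m)" for t
    using mult_mono[OF f(2)[of t] g(2)[of t]] f(1) by (simp add: abs_mult power_add ac_simps)
  then show ?thesis
    using assms unfolding poly_growth_def by (blast intro: continuous_intros)
qed

lemma poly_growth_minus [poly_growth_intros]: "poly_growth f \<Longrightarrow> poly_growth (\<lambda>t. - f t)"
  using poly_growth_mult[OF poly_growth_const[of "-1"]] by simp

lemma poly_growth_diff [poly_growth_intros]:
  "poly_growth f \<Longrightarrow> poly_growth g \<Longrightarrow> poly_growth (\<lambda>t. f t - g t)"
  using poly_growth_add[OF _ poly_growth_minus] by fastforce

lemma poly_growth_power [poly_growth_intros]: "poly_growth f \<Longrightarrow> poly_growth (\<lambda>t. f t ^ n)"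
  by (induction n) (auto intro: poly_growth_intros)

lemma poly_growth_poly [poly_growth_intros]: "poly_growth (poly p)"
proof (induction p)
  case (pCons a p)
  have "poly_growth (\<lambda>t. a + t * poly p t)"
    by (intro poly_growth_intros pCons.IH)
  then show ?case by simp
qed (simp add: poly_growth_const)

lemma poly_growth_sum [poly_growth_intros]:
  "(\<And>i. i \<in> A \<Longrightarrow> poly_growth (f i)) \<Longrightarrow> poly_growth (\<lambda>t. \<Sum>i\<in>A. f i t)"
  by (induction A rule: infinite_finite_induct) (auto intro: poly_growth_intros)

text \<open>This admits the rational entries of the weight, whose denominators stay away from zero
  on the real line.\<close>

lemma poly_growth_divide:
  assumes "poly_growth f" "poly_growth g" "c > 0" "\<And>t. c \<le> g t"
  shows "poly_growth (\<lambda>t. f t / g t)"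
proof -
  obtain C n where f: "C \<ge> 0" "\<And>t. \<bar>f t\<bar> \<le> C * (1 + t\<^sup>2) ^ n" using poly_growthE assms(1) by blast
  have pos: "g t > 0" for t using assms(3) assms(4)[of t] by linarith
  have "\<bar>f t / g t\<bar> \<le> (C / c) * (1 + t\<^sup>2) ^ n" for t
    using frac_le[OF _ f(2)[of t] assms(3) assms(4)[of t]] pos[of t] f(1) by (simp add: abs_divide)
  moreover have "continuous_on UNIV (\<lambda>t. f t / g t)"
    using pos by (intro continuous_intros poly_growth_continuous assms) (metis less_irrefl)
  ultimately show ?thesis unfolding poly_growth_def by blast
qed

section \<open>Domination by Gaussians and vanishing boundary terms\<close>

lemma power_le_fact_mult_exp:
  fixes x :: real
  assumes "x \<ge> 0"
  shows "x ^ n \<le> fact n * exp x"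
proof -
  have "(\<Sum>i\<in>{n}. inverse (fact i) * x ^ i) \<le> (\<Sum>i. inverse (fact i) * x ^ i)"
    using summable_exp[of x] assms by (intro sum_le_suminf) auto
  then have "inverse (fact n) * x ^ n \<le> exp x" by (simp add: exp_def)
  then show ?thesis by (simp add: field_simps)
qed

lemma poly_growth_gauss_bound:
  assumes "poly_growth f"
  obtains C where "C \<ge> 0" "\<And>t. \<bar>f t * exp (- (t\<^sup>2))\<bar> \<le> C * exp (- (t\<^sup>2) / 2)"
proof -
  obtain C n where f: "C \<ge> 0" "\<And>t. \<bar>f t\<bar> \<le> C * (1 + t\<^sup>2) ^ n" using poly_growthE assms(1) by blast
  have "\<bar>f t * exp (- (t\<^sup>2))\<bar> \<le> (C * (2 ^ n * (fact n * exp (1/2)))) * exp (- (t\<^sup>2) / 2)" for t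
  proof -
    \<comment> \<open>Halving \<open>1 + t\<^sup>2\<close> before comparing with the exponential
      spends only half of the Gaussian; the other half survives as the bound.\<close>
    have "(1 + t\<^sup>2) ^ n = 2 ^ n * ((1 + t\<^sup>2) / 2) ^ n" by (simp add: power_divide)
    also have "\<dots> \<le> 2 ^ n * (fact n * exp ((1 + t\<^sup>2) / 2))"
      by (intro mult_left_mono power_le_fact_mult_exp) auto
    finally have "C * (1 + t\<^sup>2) ^ n \<le> C * (2 ^ n * (fact n * exp ((1 + t\<^sup>2) / 2)))"
      using f(1) by (intro mult_left_mono)
    with f(2)[of t] have "\<bar>f t\<bar> \<le> C * (2 ^ n * (fact n * exp ((1 + t\<^sup>2) / 2)))" by linarith
    then have "\<bar>f t\<bar> * exp (- (t\<^sup>2)) \<le> C * (2 ^ n * (fact n * exp ((1 + t\<^sup>2) / 2))) * exp (- (t\<^sup>2))"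
      by (intro mult_right_mono) auto
    also have "\<dots> = C * (2 ^ n * (fact n * (exp ((1 + t\<^sup>2) / 2) * exp (- (t\<^sup>2)))))"
      by simp
    also have "exp ((1 + t\<^sup>2) / 2) * exp (- (t\<^sup>2)) = exp (1/2) * exp (- (t\<^sup>2) / 2)"
      by (simp add: mult_exp_exp field_simps)
    finally show ?thesis by (simp add: abs_mult ac_simps)
  qed
  moreover have "C * (2 ^ n * (fact n * exp (1/2))) \<ge> 0" using f(1) by simp
  ultimately show ?thesis using that by blast
qed

text \<open>Up to a constant factor the integrand is the normal density of variance
  \<open>1 / (2 * c)\<close>.\<close>

lemma integrable_gauss:
  fixes c :: real
  assumes "c > 0"
  shows "integrable lborel (\<lambda>t. exp (- (c * t\<^sup>2)))"
proof -
  define s where "s = sqrt (1 / (2 * c))"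
  have s: "s\<^sup>2 = 1 / (2 * c)" "s > 0" using assms by (auto simp: s_def)
  have "integrable lborel (\<lambda>t. sqrt (2 * pi * s\<^sup>2) * normal_density 0 s t)"
    using s(2) by (intro integrable_mult_right integrable_normal_density)
  moreover have "sqrt (2 * pi * s\<^sup>2) * normal_density 0 s t = exp (- (c * t\<^sup>2))" for t
    using assms unfolding normal_density_def s(1) by (simp add: field_simps)
  ultimately show ?thesis by simp
qed

lemma integrable_poly_growth_gauss:
  assumes "poly_growth f"
  shows "integrable lborel (\<lambda>t. f t * exp (- (t\<^sup>2)))"
proof -
  obtain C where C: "C \<ge> 0" "\<And>t. \<bar>f t * exp (- (t\<^sup>2))\<bar> \<le> C * exp (- (t\<^sup>2) / 2)"
    using poly_growth_gauss_bound assms by blast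
  have [measurable]: "f \<in> borel_measurable borel" by (rule poly_growth_measurable[OF assms])
  have "integrable lborel (\<lambda>t. C * exp (- ((1/2) * t\<^sup>2)))"
    by (intro integrable_mult_right integrable_gauss) auto
  then show ?thesis
    by (rule Bochner_Integration.integrable_bound) (use C in \<open>auto simp: abs_mult\<close>)
qed

lemma poly_growth_gauss_tendsto_0:
  assumes "poly_growth f" "filterlim (\<lambda>t::real. t\<^sup>2) at_top F"
  shows "((\<lambda>t. f t * exp (- (t\<^sup>2))) \<longlongrightarrow> 0) F"
proof -
  obtain C where C: "C \<ge> 0" "\<And>t. \<bar>f t * exp (- (t\<^sup>2))\<bar> \<le> C * exp (- (t\<^sup>2) / 2)"
    using poly_growth_gauss_bound assms by blast
  have "filterlim (\<lambda>t::real. - (t\<^sup>2) / 2) at_bot F"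
  proof -
    have "filterlim (\<lambda>t::real. (1/2) * t\<^sup>2) at_top F"
      by (rule filterlim_tendsto_pos_mult_at_top[OF tendsto_const _ assms(2)]) simp
    then have "filterlim (\<lambda>t::real. - ((1/2) * t\<^sup>2)) at_bot F"
      by (rule filterlim_compose[OF filterlim_uminus_at_bot_at_top])
    then show ?thesis by simp
  qed
  then have "((\<lambda>t::real. exp (- (t\<^sup>2) / 2)) \<longlongrightarrow> 0) F"
    by (rule filterlim_compose[OF exp_at_bot])
  from tendsto_mult_right_zero[OF this, of C]
  show ?thesis
    by (rule Lim_null_comparison[rotated]) (use C in auto)
qed

text \<open>All integrations by parts below have this form: the Gaussian beats \<open>F\<close> at
  both ends, so a total derivative integrates to zero.\<close>

lemma has_bochner_integral_derivative_gauss: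
  assumes deriv: "\<And>t. ((\<lambda>t. F t * exp (- (t\<^sup>2))) has_real_derivative (f t * exp (- (t\<^sup>2)))) (at t)"
    and "poly_growth F" "poly_growth f"
  shows "has_bochner_integral lborel (\<lambda>t. f t * exp (- (t\<^sup>2))) 0"
proof -
  let ?f = "\<lambda>t. f t * exp (- (t\<^sup>2))" and ?F = "\<lambda>t. F t * exp (- (t\<^sup>2))"
  have int: "integrable lborel ?f" by (rule integrable_poly_growth_gauss) fact
  have cont: "continuous_on UNIV ?f"
    by (intro continuous_intros poly_growth_continuous assms)
  have "(LBINT t=-\<infinity>..\<infinity>. ?f t) = 0 - 0"
  proof (rule interval_integral_FTC_integrable[where F = ?F])
    show "(?F has_vector_derivative ?f t) (at t)" for t
      using deriv[of t] by (simp add: has_real_derivative_iff_has_vector_derivative)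
    show "isCont ?f t" for t
      using cont by (simp add: continuous_on_eq_continuous_at)
    show "set_integrable lborel (einterval (-\<infinity>) \<infinity>) ?f"
      using int by (simp add: set_integrable_def)
    have "filterlim (\<lambda>t::real. t\<^sup>2) at_top at_top" "filterlim (\<lambda>t::real. t\<^sup>2) at_top at_bot"
      by (simp_all add: filterlim_pow_at_top filterlim_pow_at_bot_even filterlim_ident)
    then have "(?F \<longlongrightarrow> 0) at_bot" "(?F \<longlongrightarrow> 0) at_top"
      by (blast intro: poly_growth_gauss_tendsto_0 assms)+
    then show "((?F \<circ> real_of_ereal) \<longlongrightarrow> 0) (at_right (-\<infinity>))" "((?F \<circ> real_of_ereal) \<longlongrightarrow> 0) (at_left \<infinity>)"
      by (simp_all only: ereal_tendsto_simps)
  qed auto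
  then have "integral\<^sup>L lborel ?f = 0"
    by (simp add: interval_lebesgue_integral_def set_lebesgue_integral_def)
  with int show ?thesis by (simp add: has_bochner_integral_iff)
qed

section \<open>Polynomial approximation in Gaussian mean square\<close>

text \<open>The exponent is \<open>- (t\<^sup>2) / 2\<close> because half of the Gaussian is given
  up to absorb the polynomial growth of \<open>q ^ 4\<close> times the weight entries. Integrability
  is demanded separately, since a divergent integral has the default value 0.\<close>

definition gauss_approximable :: "(real \<Rightarrow> real) \<Rightarrow> bool" where
  "gauss_approximable g \<longleftrightarrow> (\<forall>e>0. \<exists>p::real poly.
     integrable lborel (\<lambda>t. (g t - poly p t)\<^sup>2 * exp (- (t\<^sup>2) / 2)) \<and>
     (LINT t|lborel. (g t - poly p t)\<^sup>2 * exp (- (t\<^sup>2) / 2)) < e)"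

lemma gauss_approximable_poly: "gauss_approximable (poly p)"
  unfolding gauss_approximable_def by (intro allI impI exI[of _ p]) simp

lemma integrable_half_gauss: "integrable lborel (\<lambda>t::real. exp (- (t\<^sup>2) / 2))"
  using integrable_gauss[of "1/2"] by simp

text \<open>Dominated convergence closes the class under almost everywhere limits. It leads from
  polynomials to functions of exponential type, then to bounded continuous and finally to bounded
  measurable functions.\<close>

lemma gauss_approximable_limit:
  fixes g :: "real \<Rightarrow> real" and D :: "real \<Rightarrow> real"
  assumes gn: "\<And>n. gauss_approximable (gn n)"
    and [measurable]: "\<And>n. gn n \<in> borel_measurable borel" "g \<in> borel_measurable borel"
    and lim: "AE t in lborel. (\<lambda>n. gn n t) \<longlonglongrightarrow> g t"
    and bound: "\<And>n t. (gn n t - g t)\<^sup>2 \<le> D t"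
    and D: "integrable lborel (\<lambda>t. D t * exp (- (t\<^sup>2) / 2))"
  shows "gauss_approximable g"
  unfolding gauss_approximable_def
proof (intro allI impI)
  fix e :: real assume "e > 0"
  define w :: "real \<Rightarrow> real" where "w t = exp (- (t\<^sup>2) / 2)" for t
  have [measurable]: "w \<in> borel_measurable borel" unfolding w_def by measurable
  have w: "w t \<ge> 0" for t by (simp add: w_def)
  have dom: "norm ((gn n t - g t)\<^sup>2 * w t) \<le> D t * w t" for n t
    using mult_right_mono[OF bound[of n t] w[of t]] w[of t] by (simp add: abs_mult)
  have D': "integrable lborel (\<lambda>t. D t * w t)" using D by (simp add: w_def)
  have intn: "integrable lborel (\<lambda>t. (gn n t - g t)\<^sup>2 * w t)" for n
    by (rule Bochner_Integration.integrable_bound[OF D'])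
       (measurable, intro AE_I2 order_trans[OF dom], simp)
  have "(\<lambda>n. LINT t|lborel. (gn n t - g t)\<^sup>2 * w t) \<longlonglongrightarrow> (LINT t::real|lborel. (0::real))"
  proof (rule integral_dominated_convergence[where w = "\<lambda>t. D t * w t"])
    show "AE t in lborel. (\<lambda>n. (gn n t - g t)\<^sup>2 * w t) \<longlonglongrightarrow> 0"
      using lim
    proof eventually_elim
      case (elim t)
      have "(\<lambda>n. (gn n t - g t)\<^sup>2 * w t) \<longlonglongrightarrow> (g t - g t)\<^sup>2 * w t"
        by (intro tendsto_intros elim)
      then show ?case by simp
    qed
    show "AE t in lborel. norm ((gn n t - g t)\<^sup>2 * w t) \<le> D t * w t" for n
      by (intro AE_I2 dom)
  qed (measurable, fact D')
  \<comment> \<open>Two errors of size \<open>e / 4\<close> suffice, since the square of a sum is at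
    most twice the sum of the squares.\<close>
  then have "\<forall>\<^sub>F n in sequentially. (LINT t|lborel. (gn n t - g t)\<^sup>2 * w t) < e / 4"
    using \<open>e > 0\<close> by (intro order_tendstoD(2)[where a = "e/4"]) auto
  then obtain n where n: "(LINT t|lborel. (gn n t - g t)\<^sup>2 * w t) < e / 4"
    using eventually_happens'[OF sequentially_bot] by blast
  from \<open>e > 0\<close> have "e / 4 > 0" by simp
  then obtain p :: "real poly" where
    p: "integrable lborel (\<lambda>t. (gn n t - poly p t)\<^sup>2 * w t)"
       "(LINT t|lborel. (gn n t - poly p t)\<^sup>2 * w t) < e / 4"
    using gn[of n] unfolding gauss_approximable_def w_def by blast
  have le: "(g t - poly p t)\<^sup>2 * w t
      \<le> 2 * ((gn n t - g t)\<^sup>2 * w t) + 2 * ((gn n t - poly p t)\<^sup>2 * w t)" for t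
  proof -
    \<comment> \<open>The two sides of the next inequality differ by exactly this square.\<close>
    have "0 \<le> ((gn n t - g t) + (gn n t - poly p t))\<^sup>2" by simp
    then have "(g t - poly p t)\<^sup>2 \<le> 2 * (gn n t - g t)\<^sup>2 + 2 * (gn n t - poly p t)\<^sup>2"
      by (simp add: power2_eq_square algebra_simps)
    from mult_right_mono[OF this w[of t]] show ?thesis by (simp add: algebra_simps)
  qed
  have int2: "integrable lborel (\<lambda>t. 2 * ((gn n t - g t)\<^sup>2 * w t) + 2 * ((gn n t - poly p t)\<^sup>2 * w t))"
    by (intro Bochner_Integration.integrable_add integrable_mult_right intn p)
  have int: "integrable lborel (\<lambda>t. (g t - poly p t)\<^sup>2 * w t)"
  proof (rule Bochner_Integration.integrable_bound[OF int2])
    have [measurable]: "poly p \<in> borel_measurable borel"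
      by (rule poly_growth_measurable[OF poly_growth_poly])
    show "(\<lambda>t. (g t - poly p t)\<^sup>2 * w t) \<in> borel_measurable lborel" by measurable
    have "norm ((g t - poly p t)\<^sup>2 * w t)
        \<le> norm (2 * ((gn n t - g t)\<^sup>2 * w t) + 2 * ((gn n t - poly p t)\<^sup>2 * w t))" for t
      using order_trans[OF le[of t] abs_ge_self] w[of t] by (simp add: abs_mult)
    then show "AE t in lborel. norm ((g t - poly p t)\<^sup>2 * w t)
        \<le> norm (2 * ((gn n t - g t)\<^sup>2 * w t) + 2 * ((gn n t - poly p t)\<^sup>2 * w t))"
      by (intro AE_I2)
  qed
  have "(LINT t|lborel. (g t - poly p t)\<^sup>2 * w t)
      \<le> (LINT t|lborel. 2 * ((gn n t - g t)\<^sup>2 * w t) + 2 * ((gn n t - poly p t)\<^sup>2 * w t))"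
    by (rule integral_mono[OF int int2 le])
  also have "\<dots> = 2 * (LINT t|lborel. (gn n t - g t)\<^sup>2 * w t) + 2 * (LINT t|lborel. (gn n t - poly p t)\<^sup>2 * w t)"
    using intn p(1) by simp
  also have "\<dots> < e" using n p(2) by simp
  finally show "\<exists>p::real poly. integrable lborel (\<lambda>t. (g t - poly p t)\<^sup>2 * exp (- (t\<^sup>2) / 2)) \<and>
     (LINT t|lborel. (g t - poly p t)\<^sup>2 * exp (- (t\<^sup>2) / 2)) < e"
    using int unfolding w_def by blast
qed

text \<open>Coefficients bounded by \<open>C K\<^sup>n / n!\<close> make the Taylor polynomials of \<open>f\<close> at most \<open>C exp (K \<bar>t\<bar>)\<close>,
  which is square integrable against the Gaussian, so they converge to \<open>f\<close> in mean square.\<close>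

definition exp_type :: "(real \<Rightarrow> real) \<Rightarrow> bool" where
  "exp_type f \<longleftrightarrow> (\<exists>c C K. 0 \<le> C \<and> 0 \<le> K \<and> (\<forall>n. \<bar>c n\<bar> \<le> C * K ^ n / fact n) \<and>
     (\<forall>t. (\<lambda>n. c n * t ^ n) sums f t))"

lemma exp_typeI:
  assumes "0 \<le> C" "0 \<le> K" "\<And>n. \<bar>c n\<bar> \<le> C * K ^ n / fact n"
    and "\<And>t. (\<lambda>n. c n * t ^ n) sums f t"
  shows "exp_type f"
  using assms unfolding exp_type_def by blast

lemma sums_exp_real: "(\<lambda>n. x ^ n / fact n) sums exp (x::real)"
  using exp_converges[of x] by (simp add: divide_inverse mult.commute)

lemma exp_type_coeff_summable:
  fixes c :: "nat \<Rightarrow> real"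
  assumes "0 \<le> C" "\<And>n. \<bar>c n\<bar> \<le> C * K ^ n / fact n"
  shows "\<bar>c n * t ^ n\<bar> \<le> C * ((K * \<bar>t\<bar>) ^ n / fact n)"
    and "summable (\<lambda>n. norm (c n * t ^ n))"
proof -
  show le: "\<bar>c n * t ^ n\<bar> \<le> C * ((K * \<bar>t\<bar>) ^ n / fact n)" for n
    using mult_right_mono[OF assms(2)[of n], of "\<bar>t\<bar> ^ n"]
    by (simp add: abs_mult power_abs power_mult_distrib ac_simps)
  show "summable (\<lambda>n. norm (c n * t ^ n))"
    by (rule summable_comparison_test'[of "\<lambda>n. C * ((K * \<bar>t\<bar>) ^ n / fact n)" 0])
       (use le in \<open>auto intro!: summable_mult sums_exp_real[THEN sums_summable] simp del: times_divide_eq_right\<close>)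
qed

lemma exp_type_const: "exp_type (\<lambda>t. k)"
  unfolding exp_type_def
proof (intro exI conjI allI)
  \<comment> \<open>With growth constant \<open>K = 0\<close> the bound is
    \<open>\<bar>k\<bar>\<close> at \<open>n = 0\<close>, because \<open>0 ^ 0 = 1\<close>, and 0
    afterwards.\<close>
  show "\<bar>if n = 0 then k else 0\<bar> \<le> \<bar>k\<bar> * 0 ^ n / fact n" for n :: nat by simp
  show "(\<lambda>n. (if n = 0 then k else 0) * t ^ n) sums k" for t :: real
  proof -
    have "(\<lambda>n. if n = 0 then k else 0) sums k" by (rule sums_single)
    moreover have "(if n = 0 then k else 0) * t ^ n = (if n = 0 then k else 0)" for n :: nat by simp
    ultimately show ?thesis by (simp only:)
  qed
qed auto

lemma exp_type_add:
  assumes "exp_type f" "exp_type g"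
  shows "exp_type (\<lambda>t. f t + g t)"
proof -
  obtain c C K where f: "0 \<le> C" "0 \<le> K" "\<And>n. \<bar>c n\<bar> \<le> C * K ^ n / fact n" "\<And>t. (\<lambda>n. c n * t ^ n) sums f t"
    using assms(1) unfolding exp_type_def by blast
  obtain d D L where g: "0 \<le> D" "0 \<le> L" "\<And>n. \<bar>d n\<bar> \<le> D * L ^ n / fact n" "\<And>t. (\<lambda>n. d n * t ^ n) sums g t"
    using assms(2) unfolding exp_type_def by blast
  have "\<bar>c n + d n\<bar> \<le> (C + D) * (max K L) ^ n / fact n" for n
  proof -
    have "C * K ^ n / fact n \<le> C * (max K L) ^ n / fact n" "D * L ^ n / fact n \<le> D * (max K L) ^ n / fact n"
      using f g by (auto intro!: divide_right_mono mult_left_mono power_mono)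
    with f(3)[of n] g(3)[of n] show ?thesis by (simp add: algebra_simps add_divide_distrib)
  qed
  moreover have "(\<lambda>n. (c n + d n) * t ^ n) sums (f t + g t)" for t
    using sums_add[OF f(4)[of t] g(4)[of t]] by (simp add: algebra_simps)
  moreover have "0 \<le> C + D" "0 \<le> max K L" using f g by auto
  ultimately show ?thesis by (intro exp_typeI[where c = "\<lambda>n. c n + d n"])
qed

text \<open>The coefficients of the Cauchy product are convolutions; the binomial theorem sums their
  bounds to \<open>C * D * (K + L) ^ n / fact n\<close>.\<close>

lemma exp_type_mult:
  assumes "exp_type f" "exp_type g"
  shows "exp_type (\<lambda>t. f t * g t)"
proof -
  obtain c C K where f: "0 \<le> C" "0 \<le> K" "\<And>n. \<bar>c n\<bar> \<le> C * K ^ n / fact n" "\<And>t. (\<lambda>n. c n * t ^ n) sums f t"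
    using assms(1) unfolding exp_type_def by blast
  obtain d D L where g: "0 \<le> D" "0 \<le> L" "\<And>n. \<bar>d n\<bar> \<le> D * L ^ n / fact n" "\<And>t. (\<lambda>n. d n * t ^ n) sums g t"
    using assms(2) unfolding exp_type_def by blast
  define e where "e n = (\<Sum>i\<le>n. c i * d (n - i))" for n
  have "\<bar>e n\<bar> \<le> (C * D) * (K + L) ^ n / fact n" for n
  proof -
    have "\<bar>e n\<bar> \<le> (\<Sum>i\<le>n. \<bar>c i * d (n - i)\<bar>)" unfolding e_def by (rule sum_abs)
    also have "\<dots> \<le> (\<Sum>i\<le>n. (C * K ^ i / fact i) * (D * L ^ (n - i) / fact (n - i)))"
      unfolding abs_mult by (intro sum_mono mult_mono f g) (use f g in auto)
    also have "\<dots> = (\<Sum>i\<le>n. (C * D) / fact n * (of_nat (n choose i) * K ^ i * L ^ (n - i)))"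
      by (intro sum.cong refl) (simp add: binomial_fact field_simps)
    also have "\<dots> = (C * D) * (K + L) ^ n / fact n"
      unfolding sum_distrib_left[symmetric] binomial_ring by simp
    finally show ?thesis .
  qed
  moreover have "(\<lambda>n. e n * t ^ n) sums (f t * g t)" for t
  proof -
    have "(\<lambda>n. \<Sum>i\<le>n. (c i * t ^ i) * (d (n - i) * t ^ (n - i))) sums
        ((\<Sum>n. c n * t ^ n) * (\<Sum>n. d n * t ^ n))"
      by (intro Cauchy_product_sums exp_type_coeff_summable[OF f(1,3)] exp_type_coeff_summable[OF g(1,3)])
    moreover have "(\<Sum>i\<le>n. (c i * t ^ i) * (d (n - i) * t ^ (n - i))) = e n * t ^ n" for n
    proof -
      have *: "(c i * t ^ i) * (d (n - i) * t ^ (n - i)) = (c i * d (n - i)) * t ^ n" if "i \<le> n" for i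
        using power_add[of t i "n - i"] that by (simp add: ac_simps)
      show ?thesis unfolding e_def sum_distrib_right by (intro sum.cong refl, rule *) simp
    qed
    ultimately show ?thesis using f(4)[of t] g(4)[of t] by (simp add: sums_iff)
  qed
  moreover have "0 \<le> C * D" "0 \<le> K + L" using f g by auto
  ultimately show ?thesis by (intro exp_typeI[where c = e])
qed

lemma exp_type_trig:
  shows "exp_type (\<lambda>t. cos (\<omega> * t))" "exp_type (\<lambda>t. sin (\<omega> * t))"
proof -
  have *: "\<bar>a * \<omega> ^ n\<bar> \<le> 1 * \<bar>\<omega>\<bar> ^ n / fact n" if "\<bar>a\<bar> \<le> 1 / fact n" for a n
    using mult_right_mono[OF that, of "\<bar>\<omega>\<bar> ^ n"] by (simp add: abs_mult power_abs)
  have c: "\<bar>cos_coeff n\<bar> \<le> 1 / fact n" "\<bar>sin_coeff n\<bar> \<le> 1 / fact n" for n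
    by (auto simp: cos_coeff_def sin_coeff_def abs_mult power_abs)
  show "exp_type (\<lambda>t. cos (\<omega> * t))"
    unfolding exp_type_def
  proof (intro exI conjI allI)
    show "\<bar>cos_coeff n * \<omega> ^ n\<bar> \<le> 1 * \<bar>\<omega>\<bar> ^ n / fact n" for n by (rule *[OF c(1)])
    show "(\<lambda>n. cos_coeff n * \<omega> ^ n * t ^ n) sums cos (\<omega> * t)" for t
      using cos_converges[of "\<omega> * t"] by (simp add: power_mult_distrib mult.assoc)
  qed auto
  show "exp_type (\<lambda>t. sin (\<omega> * t))"
    unfolding exp_type_def
  proof (intro exI conjI allI)
    show "\<bar>sin_coeff n * \<omega> ^ n\<bar> \<le> 1 * \<bar>\<omega>\<bar> ^ n / fact n" for n by (rule *[OF c(2)])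
    show "(\<lambda>n. sin_coeff n * \<omega> ^ n * t ^ n) sums sin (\<omega> * t)" for t
      using sin_converges[of "\<omega> * t"] by (simp add: power_mult_distrib mult.assoc)
  qed auto
qed

text \<open>A real linear functional of \<open>cis\<close> is a combination of cosine and sine, and
  the class is closed under sums and products.\<close>

lemma exp_type_real_polynomial_function_cis:
  assumes "real_polynomial_function p"
  shows "exp_type (\<lambda>t. p (cis (\<omega> * t)))"
  using assms
proof (induction p rule: real_polynomial_function.induct)
  case (linear f)
  then interpret bounded_linear f .
  have "f (cis (\<omega> * t)) = cos (\<omega> * t) * f 1 + sin (\<omega> * t) * f \<i>" for t
  proof -
    have "cis (\<omega> * t) = cos (\<omega> * t) *\<^sub>R 1 + sin (\<omega> * t) *\<^sub>R \<i>" by (simp add: complex_eq_iff)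
    then show ?thesis by (simp only: add scaleR) simp
  qed
  then show ?case by (simp add: exp_type_add exp_type_mult exp_type_const exp_type_trig)
qed (simp_all add: exp_type_const exp_type_add exp_type_mult)

lemma gauss_approximable_exp_type:
  assumes "exp_type f"
  shows "gauss_approximable f"
proof -
  obtain c C K where f: "0 \<le> C" "0 \<le> K" "\<And>n. \<bar>c n\<bar> \<le> C * K ^ n / fact n" "\<And>t. (\<lambda>n. c n * t ^ n) sums f t"
    using assms(1) unfolding exp_type_def by blast
  define gn where "gn n t = (\<Sum>i<n. c i * t ^ i)" for n :: nat and t :: real
  have poly: "gn n = poly (\<Sum>i<n. monom (c i) i)" for n
    by (auto simp: gn_def poly_sum poly_monom)
  have lim: "(\<lambda>n. gn n t) \<longlonglongrightarrow> f t" for t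
    using f(4)[of t] unfolding sums_def gn_def .
  have [measurable]: "gn n \<in> borel_measurable borel" for n
    unfolding poly by (rule poly_growth_measurable[OF poly_growth_poly])
  have gn: "\<bar>gn n t\<bar> \<le> C * exp (K * \<bar>t\<bar>)" for n t
  proof -
    have "\<bar>gn n t\<bar> \<le> (\<Sum>i<n. \<bar>c i * t ^ i\<bar>)" unfolding gn_def by (rule sum_abs)
    also have "\<dots> \<le> (\<Sum>i<n. C * ((K * \<bar>t\<bar>) ^ i / fact i))"
      by (intro sum_mono exp_type_coeff_summable[OF f(1,3)])
    also have "\<dots> \<le> (\<Sum>i. C * ((K * \<bar>t\<bar>) ^ i / fact i))"
      using f(1,2) by (intro sum_le_suminf summable_mult sums_exp_real[THEN sums_summable]) auto
    also have "\<dots> = C * exp (K * \<bar>t\<bar>)"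
      using sums_mult[OF sums_exp_real, of C "K * \<bar>t\<bar>"] by (simp add: sums_iff)
    finally show ?thesis .
  qed
  have fb: "\<bar>f t\<bar> \<le> C * exp (K * \<bar>t\<bar>)" for t
    by (rule LIMSEQ_le_const2[OF tendsto_rabs[OF lim]]) (use gn in auto)
  have [measurable]: "f \<in> borel_measurable borel"
    by (rule borel_measurable_LIMSEQ_real[OF lim]) auto
  show ?thesis
  proof (rule gauss_approximable_limit[where gn = gn and D = "\<lambda>t. (2 * C * exp (K * \<bar>t\<bar>))\<^sup>2"])
    show "gauss_approximable (gn n)" for n unfolding poly by (rule gauss_approximable_poly)
    show "(gn n t - f t)\<^sup>2 \<le> (2 * C * exp (K * \<bar>t\<bar>))\<^sup>2" for n t
      using gn[of n t] fb[of t] by (intro power2_le_iff_abs_le[THEN iffD2]) (use f(1) in auto)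
    have "integrable lborel (\<lambda>t. 4 * C\<^sup>2 * exp (4 * K\<^sup>2) * exp (- ((1/4) * t\<^sup>2)))"
      by (intro integrable_mult_right integrable_gauss) auto
    then show "integrable lborel (\<lambda>t. (2 * C * exp (K * \<bar>t\<bar>))\<^sup>2 * exp (- (t\<^sup>2) / 2))"
    proof (rule Bochner_Integration.integrable_bound)
      have "norm ((2 * C * exp (K * \<bar>t\<bar>))\<^sup>2 * exp (- (t\<^sup>2) / 2))
          \<le> norm (4 * C\<^sup>2 * exp (4 * K\<^sup>2) * exp (- ((1/4) * t\<^sup>2)))" for t
      proof -
        \<comment> \<open>Completing the square trades the growth
          \<open>exp (2 * K * \<bar>t\<bar>)\<close> for half of the remaining Gaussian
          exponent.\<close>
        have "0 \<le> (2 * K - \<bar>t\<bar> / 2)\<^sup>2" by simp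
        then have le: "2 * (K * \<bar>t\<bar>) - t\<^sup>2 / 2 \<le> 4 * K\<^sup>2 - (1/4) * t\<^sup>2"
          by (simp add: power2_eq_square algebra_simps)
        have "(2 * C * exp (K * \<bar>t\<bar>))\<^sup>2 * exp (- (t\<^sup>2) / 2) = 4 * C\<^sup>2 * exp (2 * (K * \<bar>t\<bar>) - t\<^sup>2 / 2)"
        proof -
          have "(exp (K * \<bar>t\<bar>))\<^sup>2 * exp (- (t\<^sup>2) / 2) = exp (2 * (K * \<bar>t\<bar>) - t\<^sup>2 / 2)"
            by (simp add: power2_eq_square mult_exp_exp)
          then show ?thesis by (simp add: power_mult_distrib)
        qed
        also have "\<dots> \<le> 4 * C\<^sup>2 * exp (4 * K\<^sup>2 - (1/4) * t\<^sup>2)"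
          using le by (intro mult_left_mono) auto
        also have "\<dots> = 4 * C\<^sup>2 * exp (4 * K\<^sup>2) * exp (- ((1/4) * t\<^sup>2))"
          by (simp add: mult_exp_exp)
        finally show ?thesis by (simp add: abs_mult)
      qed
      then show "AE t in lborel. norm ((2 * C * exp (K * \<bar>t\<bar>))\<^sup>2 * exp (- (t\<^sup>2) / 2))
          \<le> norm (4 * C\<^sup>2 * exp (4 * K\<^sup>2) * exp (- ((1/4) * t\<^sup>2)))" by simp
    qed measurable
    show "AE t in lborel. (\<lambda>n. gn n t) \<longlonglongrightarrow> f t" using lim by simp
  qed measurable
qed

text \<open>The interval from \<open>- L\<close> to \<open>L\<close> is wrapped around the unit
  circle, where Stone-Weierstrass applies. The factor \<open>(1 + cos (pi / L * t)) / 2\<close>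
  vanishes where the ends meet and tends to 1 as \<open>L\<close> grows. The last bound holds for
  all \<open>t\<close>, since it only concerns values on the circle.\<close>

lemma trig_approximation:
  fixes g :: "real \<Rightarrow> real"
  assumes g: "continuous_on UNIV g" "\<And>t. \<bar>g t\<bar> \<le> B" and "L > 0" "e > 0"
  obtains p where "real_polynomial_function p"
    "\<And>t. \<bar>t\<bar> < L \<Longrightarrow> \<bar>g t * ((1 + cos (pi / L * t)) / 2) - p (cis (pi / L * t))\<bar> < e"
    "\<And>t. \<bar>p (cis (pi / L * t))\<bar> \<le> B + e"
proof -
  \<comment> \<open>The factor vanishes at the cut of \<^const>\<open>Arg\<close>, which makes \<open>F\<close> continuous on the circle.\<close>
  define F where "F z = g (L / pi * Arg z) * ((1 + Re z) / 2)" for z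
  have B: "B \<ge> 0" using g(2)[of 0] by linarith
  have "continuous (at z within sphere 0 1) F" if "z \<in> sphere 0 1" for z
  proof (cases "z \<in> \<real>\<^sub>\<le>\<^sub>0")
    case False
    have "isCont g x" for x using g(1) by (simp add: continuous_on_eq_continuous_at)
    then have "isCont (\<lambda>z. g (L / pi * Arg z)) z"
      by (rule isCont_o2[rotated]) (intro continuous_intros continuous_at_Arg[OF False])
    then have "isCont F z" unfolding F_def by (intro continuous_intros) auto
    then show ?thesis by (rule continuous_at_imp_continuous_at_within)
  next
    case True
    then obtain r where "z = of_real r" "r \<le> 0" by (auto elim: nonpos_Reals_cases)
    with that have z: "z = -1" by auto
    \<comment> \<open>The argument jumps at \<open>-1\<close>, but \<open>g\<close> is bounded and
      the damping factor tends to 0 there.\<close>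
    have "(F \<longlongrightarrow> 0) (at z)"
    proof (rule Lim_null_comparison)
      show "\<forall>\<^sub>F y in at z. norm (F y) \<le> B * \<bar>(1 + Re y) / 2\<bar>"
        unfolding F_def by (intro always_eventually allI) (simp add: abs_mult mult_right_mono g)
      have "((\<lambda>y. B * \<bar>(1 + Re y) / 2\<bar>) \<longlongrightarrow> B * \<bar>(1 + Re z) / 2\<bar>) (at z)"
        by (intro tendsto_intros) auto
      then show "((\<lambda>y. B * \<bar>(1 + Re y) / 2\<bar>) \<longlongrightarrow> 0) (at z)" by (simp add: z)
    qed
    then have "isCont F z" by (simp add: isCont_def F_def z)
    then show ?thesis by (rule continuous_at_imp_continuous_at_within)
  qed
  then have "continuous_on (sphere 0 1) F" by (simp add: continuous_on_eq_continuous_within)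
  from Stone_Weierstrass_real_polynomial_function[OF compact_sphere this \<open>e > 0\<close>]
  obtain p where p: "real_polynomial_function p" "\<And>z. z \<in> sphere 0 1 \<Longrightarrow> \<bar>F z - p z\<bar> < e"
    by blast
  have F: "\<bar>F z\<bar> \<le> B" if "z \<in> sphere 0 1" for z
  proof -
    have "\<bar>Re z\<bar> \<le> 1" using abs_Re_le_cmod[of z] that by simp
    then have "\<bar>(1 + Re z) / 2\<bar> \<le> 1" by (auto simp: abs_le_iff)
    from mult_mono[OF g(2) this] B show ?thesis by (simp add: F_def abs_mult)
  qed
  show ?thesis
  proof (rule that[OF p(1)])
    fix t :: real
    have s: "cis (pi / L * t) \<in> sphere 0 1" by simp
    show "\<bar>p (cis (pi / L * t))\<bar> \<le> B + e" using p(2)[OF s] F[OF s] by linarith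
    assume "\<bar>t\<bar> < L"
    then have "- pi < pi / L * t" "pi / L * t \<le> pi" using \<open>L > 0\<close> mult_strict_left_mono[of "- L" t pi] by (auto simp: field_simps abs_less_iff)
    then have "Arg (cis (pi / L * t)) = pi / L * t" by (intro Arg_cis) auto
    then show "\<bar>g t * ((1 + cos (pi / L * t)) / 2) - p (cis (pi / L * t))\<bar> < e"
      using p(2)[OF s] \<open>L > 0\<close> by (simp add: F_def)
  qed
qed

text \<open>Take \<open>L = n + 1\<close> and error \<open>1 / (n + 1)\<close>: every fixed
  \<open>t\<close> eventually lies inside the interval and the damping factor tends to 1. The
  uniform bound on the approximants supplies a constant dominating function.\<close>

lemma gauss_approximable_bounded_continuous:
  fixes g :: "real \<Rightarrow> real"
  assumes g: "continuous_on UNIV g" "\<And>t. \<bar>g t\<bar> \<le> B"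
  shows "gauss_approximable g"
proof -
  have B: "B \<ge> 0" using g(2)[of 0] by linarith
  have "\<exists>p. real_polynomial_function p \<and>
    (\<forall>t. \<bar>t\<bar> < real (Suc n) \<longrightarrow> \<bar>g t * ((1 + cos (pi / real (Suc n) * t)) / 2) - p (cis (pi / real (Suc n) * t))\<bar> < 1 / real (Suc n)) \<and>
    (\<forall>t. \<bar>p (cis (pi / real (Suc n) * t))\<bar> \<le> B + 1 / real (Suc n))" for n :: nat
    by (rule trig_approximation[OF g, of "real (Suc n)" "1 / real (Suc n)"]) auto
  then obtain p where p: "\<And>n. real_polynomial_function (p n)"
    "\<And>n t. \<bar>t\<bar> < real (Suc n) \<Longrightarrow> \<bar>g t * ((1 + cos (pi / real (Suc n) * t)) / 2) - p n (cis (pi / real (Suc n) * t))\<bar> < 1 / real (Suc n)"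
    "\<And>n t. \<bar>p n (cis (pi / real (Suc n) * t))\<bar> \<le> B + 1 / real (Suc n)"
    by metis
  define gn where "gn n t = p n (cis (pi / real (Suc n) * t))" for n t
  have et: "exp_type (gn n)" for n
    unfolding gn_def by (rule exp_type_real_polynomial_function_cis) (rule p)
  have lim: "(\<lambda>n. gn n t) \<longlonglongrightarrow> g t" for t
  proof -
    have 0: "(\<lambda>n. 1 / real (Suc n)) \<longlonglongrightarrow> 0" by (rule LIMSEQ_Suc[OF lim_1_over_n])
    have "(\<lambda>n. g t * ((1 + cos (pi * (1 / real (Suc n)) * t)) / 2)) \<longlonglongrightarrow> g t * ((1 + cos (pi * 0 * t)) / 2)"
      by (intro tendsto_intros 0) auto
    then have 1: "(\<lambda>n. g t * ((1 + cos (pi / real (Suc n) * t)) / 2)) \<longlonglongrightarrow> g t" by simp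
    have "\<forall>\<^sub>F n in sequentially. \<bar>t\<bar> < real (Suc n)"
      using filterlim_compose[OF filterlim_real_sequentially filterlim_Suc] by (simp add: filterlim_at_top_dense)
    then have "\<forall>\<^sub>F n in sequentially. norm (g t * ((1 + cos (pi / real (Suc n) * t)) / 2) - gn n t) \<le> 1 / real (Suc n)"
      by eventually_elim (use p(2)[of t] in \<open>auto simp: gn_def intro!: less_imp_le\<close>)
    from Lim_null_comparison[OF this 0]
    have 2: "(\<lambda>n. g t * ((1 + cos (pi / real (Suc n) * t)) / 2) - gn n t) \<longlonglongrightarrow> 0" .
    from tendsto_diff[OF 1 2] show ?thesis by simp
  qed
  have meas: "gn n \<in> borel_measurable borel" for n
  proof -
    have "continuous_on UNIV (p n)"
      using p(1) by (simp add: continuous_on_polymonial_function real_polynomial_function_eq)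
    then have "continuous_on UNIV (\<lambda>t. p n (cis (pi / real (Suc n) * t)))"
      by (rule continuous_on_compose2) (auto intro!: continuous_intros)
    then show ?thesis unfolding gn_def by (rule borel_measurable_continuous_onI)
  qed
  show ?thesis
  proof (rule gauss_approximable_limit[where gn = gn and D = "\<lambda>t. (2 * B + 1)\<^sup>2"])
    show "gauss_approximable (gn n)" for n by (rule gauss_approximable_exp_type[OF et])
    show "gn n \<in> borel_measurable borel" for n by (rule meas)
    show "g \<in> borel_measurable borel" by (rule borel_measurable_continuous_onI) fact
    show "AE t in lborel. (\<lambda>n. gn n t) \<longlonglongrightarrow> g t" using lim by simp
    show "integrable lborel (\<lambda>t::real. (2 * B + 1)\<^sup>2 * exp (- (t\<^sup>2) / 2))"
      by (intro integrable_mult_right integrable_half_gauss)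
    fix n t
    have "1 / real (Suc n) \<le> 1" by simp
    with p(3)[of n t] g(2)[of t] have "\<bar>gn n t - g t\<bar> \<le> 2 * B + 1" unfolding gn_def by linarith
    then show "(gn n t - g t)\<^sup>2 \<le> (2 * B + 1)\<^sup>2"
      using B by (intro power2_le_iff_abs_le[THEN iffD2]) auto
  qed
qed

lemma gauss_approximable_bounded_measurable:
  fixes g :: "real \<Rightarrow> real"
  assumes [measurable]: "g \<in> borel_measurable borel" and g: "\<And>t. \<bar>g t\<bar> \<le> B"
  shows "gauss_approximable g"
proof -
  have B: "B \<ge> 0" using g[of 0] by linarith
  have "g measurable_on UNIV"
    by (rule lebesgue_measurable_imp_measurable_on_real) (auto intro: measurable_completion)
  then obtain N h where N: "negligible N" and h: "\<And>n::nat. continuous_on UNIV (h n)"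
    and lim: "\<And>t. t \<notin> N \<Longrightarrow> (\<lambda>n. h n t) \<longlonglongrightarrow> g t"
    unfolding measurable_on_def by auto
  \<comment> \<open>Clamping to the range of \<open>g\<close> makes the approximants uniformly
    bounded and leaves the limit unchanged.\<close>
  define gn where "gn n t = max (- B) (min B (h n t))" for n t
  have cont: "continuous_on UNIV (gn n)" for n
    unfolding gn_def by (intro continuous_intros h)
  have bd: "\<bar>gn n t\<bar> \<le> B" for n t using B by (auto simp: gn_def)
  show ?thesis
  proof (rule gauss_approximable_limit[where gn = gn and D = "\<lambda>t. (2 * B)\<^sup>2"])
    show "gauss_approximable (gn n)" for n
      by (rule gauss_approximable_bounded_continuous[OF cont bd])
    show "gn n \<in> borel_measurable borel" for n
      by (rule borel_measurable_continuous_onI[OF cont])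
    have "AE t in lebesgue. t \<notin> N"
      using N by (intro AE_not_in) (simp add: negligible_iff_null_sets)
    then have "AE t in lborel. t \<notin> N" by (simp add: AE_completion_iff)
    then show "AE t in lborel. (\<lambda>n. gn n t) \<longlonglongrightarrow> g t"
    proof eventually_elim
      case (elim t)
      have "(\<lambda>n. gn n t) \<longlonglongrightarrow> max (- B) (min B (g t))"
        unfolding gn_def by (intro tendsto_intros lim elim)
      moreover have "max (- B) (min B (g t)) = g t" using g[of t] by (auto simp: min_def max_def)
      ultimately show ?case by simp
    qed
    show "integrable lborel (\<lambda>t::real. (2 * B)\<^sup>2 * exp (- (t\<^sup>2) / 2))"
      by (intro integrable_mult_right integrable_half_gauss)
    fix n t
    have "\<bar>gn n t - g t\<bar> \<le> 2 * B" using bd[of n t] g[of t] by linarith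
    then show "(gn n t - g t)\<^sup>2 \<le> (2 * B)\<^sup>2"
      using B by (intro power2_le_iff_abs_le[THEN iffD2]) auto
  qed fact
qed

section \<open>Hermite polynomials\<close>

primrec hermite_poly :: "nat \<Rightarrow> real poly" where
  "hermite_poly 0 = 1"
| "hermite_poly (Suc n) = [:0, 2:] * hermite_poly n - pderiv (hermite_poly n)"

text \<open>Differentiating a polynomial times the Gaussian once more reproduces the recursion of
  \<open>hermite_poly\<close>, up to sign.\<close>

lemma hermite_eq_poly: "hermite n = poly (hermite_poly n)"
proof -
  have "(deriv ^^ n) (\<lambda>s::real. exp (- (s\<^sup>2))) = (\<lambda>t. (-1) ^ n * poly (hermite_poly n) t * exp (- (t\<^sup>2)))"
  proof (induction n)
    case (Suc n)
    have "deriv (\<lambda>t. (-1) ^ n * poly (hermite_poly n) t * exp (- (t\<^sup>2))) t =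
      (-1) ^ Suc n * poly (hermite_poly (Suc n)) t * exp (- (t\<^sup>2))" for t :: real
      by (rule DERIV_imp_deriv) (auto intro!: derivative_eq_intros poly_DERIV simp: algebra_simps)
    then show ?case by (simp add: Suc.IH fun_eq_iff)
  qed simp
  then show ?thesis
    unfolding hermite_def by (simp add: fun_eq_iff power_mult_distrib[symmetric] mult_exp_exp ac_simps)
qed

text \<open>Differentiate the recursion and insert the induction hypothesis in both derivative
  terms; they recombine, by the recursion one step lower, to a multiple of
  \<open>hermite_poly n\<close>.\<close>

lemma pderiv_hermite_poly: "pderiv (hermite_poly n) = smult (2 * real n) (hermite_poly (n - 1))"
proof (induction n)
  case (Suc n)
  have X: "pderiv [:0, 2:] = ([:2:] :: real poly)" by (simp add: pderiv_pCons)
  show ?case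
  proof (cases n)
    case (Suc m)
    then have IH: "pderiv (hermite_poly n) = smult (2 * real n) (hermite_poly m)"
      using Suc.IH by simp
    have "pderiv (hermite_poly (Suc n)) =
        [:0, 2:] * pderiv (hermite_poly n) + hermite_poly n * [:2:] - pderiv (pderiv (hermite_poly n))"
      by (simp only: hermite_poly.simps pderiv_diff pderiv_mult X)
    also have "\<dots> = smult 2 (hermite_poly n)
        + smult (2 * real n) ([:0, 2:] * hermite_poly m - pderiv (hermite_poly m))"
      unfolding IH pderiv_smult mult_smult_right smult_diff_right by simp
    also have "[:0, 2:] * hermite_poly m - pderiv (hermite_poly m) = hermite_poly n"
      using Suc by simp
    also have "smult 2 (hermite_poly n) + smult (2 * real n) (hermite_poly n) =
        smult (2 * real (Suc n)) (hermite_poly n)"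
      by (simp add: smult_add_left[symmetric])
    finally show ?thesis by simp
  qed (simp add: pderiv_diff pderiv_mult X pderiv_pCons)
qed simp

text \<open>The combination \<open>n H\<^sub>n\<^sub>-\<^sub>1\<close> makes the derivative rules below hold for \<open>n = 0\<close> as well.\<close>

definition hermite_low :: "nat \<Rightarrow> real \<Rightarrow> real" where
  "hermite_low n t = real n * hermite (n - 1) t"

lemma hermite_Suc: "hermite (Suc n) t = 2 * t * hermite n t - 2 * hermite_low n t"
  by (simp add: hermite_eq_poly hermite_low_def pderiv_hermite_poly)

lemma hermite_0 [simp]: "hermite 0 t = 1"
  by (simp add: hermite_eq_poly)

lemma DERIV_hermite: "(hermite n has_real_derivative 2 * hermite_low n t) (at t)"
  unfolding hermite_eq_poly hermite_low_def
  using poly_DERIV[of "hermite_poly n" t] by (simp add: pderiv_hermite_poly mult.assoc)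

text \<open>As \<open>2 * hermite_low n\<close> is the derivative of \<open>hermite n\<close>, this
  is Hermite's equation \<open>y'' = 2 t y' - 2 n y\<close>.\<close>

lemma DERIV_hermite_low:
  "(hermite_low n has_real_derivative (2 * t * hermite_low n t - real n * hermite n t)) (at t)"
proof (cases n)
  case (Suc m)
  have "((\<lambda>t. real n * hermite m t) has_real_derivative real n * (2 * hermite_low m t)) (at t)"
    by (intro DERIV_cmult DERIV_hermite)
  moreover have low: "hermite_low n = (\<lambda>t. real n * hermite m t)"
    using Suc by (simp add: fun_eq_iff hermite_low_def)
  moreover have "real n * (2 * hermite_low m t) = 2 * t * hermite_low n t - real n * hermite n t"
    unfolding low unfolding Suc hermite_Suc by (simp add: algebra_simps)
  ultimately show ?thesis by simp
next
  case 0
  then show ?thesis by (simp add: hermite_low_def[abs_def])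
qed

lemma poly_growth_hermite [poly_growth_intros]: "poly_growth (hermite n)"
  unfolding hermite_eq_poly by (rule poly_growth_poly)

lemma poly_growth_hermite_low [poly_growth_intros]: "poly_growth (hermite_low n)"
  unfolding hermite_low_def[abs_def] by (intro poly_growth_intros)

text \<open>The squared norm of the n-th Hermite polynomial, as \<open>hermite_inner\<close>
  shows.\<close>

definition hermite_norm :: "nat \<Rightarrow> real" where
  "hermite_norm n = sqrt pi * 2 ^ n * fact n"

lemma hermite_norm_Suc: "hermite_norm (Suc n) = 2 * real (Suc n) * hermite_norm n"
  by (simp add: hermite_norm_def algebra_simps)

text \<open>Integrating the derivative of
  \<open>hermite n t * hermite m t * exp (- (t\<^sup>2))\<close> turns raising \<open>n\<close> into
  lowering \<open>m\<close> with the factor \<open>2 * m\<close>. For \<open>n = 0\<close> and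
  \<open>m > 0\<close> the integrand is itself a total derivative.\<close>

lemma hermite_inner:
  "has_bochner_integral lborel (\<lambda>t. hermite n t * hermite m t * exp (- (t\<^sup>2)))
     (if n = m then hermite_norm n else 0)"
proof (induction n arbitrary: m)
  case 0
  show ?case
  proof (cases m)
    case 0
    have "has_bochner_integral lborel (\<lambda>x::real. exp (- (x\<^sup>2))) (2 * (sqrt pi / 2))"
      using has_bochner_integral_even_function[OF gaussian_moment_0] by simp
    then show ?thesis using 0 by (simp add: hermite_norm_def)
  next
    case (Suc k)
    have "((\<lambda>t. - hermite k t * exp (- (t\<^sup>2))) has_real_derivative hermite m t * exp (- (t\<^sup>2))) (at t)" for t
      using Suc by (auto intro!: derivative_eq_intros DERIV_hermite simp: hermite_Suc algebra_simps)
    then have "has_bochner_integral lborel (\<lambda>t. hermite m t * exp (- (t\<^sup>2))) 0"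
      by (rule has_bochner_integral_derivative_gauss) (intro poly_growth_intros)+
    then show ?thesis using Suc by simp
  qed
next
  case (Suc n)
  let ?f = "\<lambda>t. 2 * hermite n t * hermite_low m t - hermite (Suc n) t * hermite m t"
  have "((\<lambda>t. (hermite n t * hermite m t) * exp (- (t\<^sup>2))) has_real_derivative ?f t * exp (- (t\<^sup>2))) (at t)" for t
    by (auto intro!: derivative_eq_intros DERIV_hermite simp: hermite_Suc algebra_simps)
  then have 1: "has_bochner_integral lborel (\<lambda>t. ?f t * exp (- (t\<^sup>2))) 0"
    by (rule has_bochner_integral_derivative_gauss) (intro poly_growth_intros)+
  have "has_bochner_integral lborel (\<lambda>t. (2 * real m) * (hermite n t * hermite (m - 1) t * exp (- (t\<^sup>2))))
      ((2 * real m) * (if n = m - 1 then hermite_norm n else 0))"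
    by (intro has_bochner_integral_mult_right Suc.IH)
  from has_bochner_integral_diff[OF this 1]
  have "has_bochner_integral lborel (\<lambda>t. hermite (Suc n) t * hermite m t * exp (- (t\<^sup>2)))
      ((2 * real m) * (if n = m - 1 then hermite_norm n else 0))"
    by (simp add: hermite_low_def algebra_simps)
  \<comment> \<open>At \<open>m = 0\<close> the factor \<open>real m\<close> kills the spurious
    value of the truncated index \<open>m - 1\<close>.\<close>
  moreover have "(2 * real m) * (if n = m - 1 then hermite_norm n else 0) =
      (if Suc n = m then hermite_norm (Suc n) else 0)"
    by (cases m) (auto simp: hermite_norm_Suc)
  ultimately show ?case by simp
qed

lemma hermite_low_inner:
  "has_bochner_integral lborel (\<lambda>t. hermite n t * hermite_low m t * exp (- (t\<^sup>2)))
     (if Suc n = m then hermite_norm m / 2 else 0)"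
proof -
  have "has_bochner_integral lborel (\<lambda>t. real m * (hermite n t * hermite (m - 1) t * exp (- (t\<^sup>2))))
     (real m * (if n = m - 1 then hermite_norm n else 0))"
    by (intro has_bochner_integral_mult_right hermite_inner)
  moreover have "real m * (if n = m - 1 then hermite_norm n else 0) = (if Suc n = m then hermite_norm m / 2 else 0)"
    by (cases m) (auto simp: hermite_norm_Suc)
  ultimately show ?thesis by (simp add: hermite_low_def ac_simps)
qed

lemma hermite_low_low_inner:
  "has_bochner_integral lborel (\<lambda>t. hermite_low n t * hermite_low m t * exp (- (t\<^sup>2)))
     (if n = m then real n * hermite_norm n / 2 else 0)"
proof -
  have "has_bochner_integral lborel (\<lambda>t. real n * (hermite (n - 1) t * hermite_low m t * exp (- (t\<^sup>2))))
     (real n * (if Suc (n - 1) = m then hermite_norm m / 2 else 0))"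
    by (intro has_bochner_integral_mult_right hermite_low_inner)
  moreover have "real n * (if Suc (n - 1) = m then hermite_norm m / 2 else 0) = (if n = m then real n * hermite_norm n / 2 else 0)"
    by (cases n) auto
  ultimately show ?thesis by (simp add: hermite_low_def ac_simps)
qed

section \<open>Degrees and leading coefficients of the Hermite polynomials\<close>

lemma degree_hermite_poly: "degree (hermite_poly n) \<le> n"
proof (induction n)
  case (Suc n)
  have "degree ([:0, 2:] * hermite_poly n) \<le> Suc n"
    using degree_mult_le[of "[:0, 2:]" "hermite_poly n"] Suc.IH by simp
  moreover have "degree (pderiv (hermite_poly n)) \<le> Suc n"
    using Suc.IH by (simp add: degree_pderiv)
  ultimately show ?case by (simp add: degree_diff_le)
qed simp

lemma coeff_hermite_poly: "coeff (hermite_poly n) n = 2 ^ n"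
proof (induction n)
  case (Suc n)
  have "coeff (pderiv (hermite_poly n)) (Suc n) = 0"
    using degree_hermite_poly[of n] by (simp add: coeff_pderiv coeff_eq_0)
  then show ?case using Suc.IH by simp
qed simp

section \<open>Integration by parts for the exceptional weight\<close>

locale exceptional_weight =
  fixes a :: real
  assumes a_sq: "a\<^sup>2 > 2"
begin

definition k :: real where "k = a\<^sup>2 - 2"

text \<open>This is \<open>- pfun a\<close>, which \<open>a\<^sup>2 > 2\<close> makes positive, so
  the weight has no real poles.\<close>

definition q :: "real \<Rightarrow> real" where "q t = 2 * k * t\<^sup>2 + a\<^sup>2"

lemma k_pos: "k > 0" and q_ge: "q t \<ge> 2" and q_pos: "q t > 0"
proof -
  show k: "k > 0" using a_sq by (simp add: k_def)
  then have "2 * k * t\<^sup>2 \<ge> 0" by simp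
  then show "q t \<ge> 2" "q t > 0" using a_sq by (simp_all add: q_def)
qed

lemma nonzero [simp]: "k \<noteq> 0" "q t \<noteq> 0"
  using k_pos q_pos[of t] by auto

text \<open>Once denominators are cleared, the identities below are polynomial consequences of this
  relation and \<open>q_relation\<close>.\<close>

lemma a_relation: "a * a = k + 2"
  by (simp add: k_def power2_eq_square)

lemma q_relation: "q t = 2 * k * t * t + k + 2"
  using a_relation by (simp add: q_def power2_eq_square)

lemma poly_growth_q [poly_growth_intros]: "poly_growth q"
  unfolding q_def[abs_def] by (intro poly_growth_intros)

lemma poly_growth_divide_q [poly_growth_intros]:
  "poly_growth f \<Longrightarrow> poly_growth (\<lambda>t. f t / q t)"
  by (rule poly_growth_divide[OF _ poly_growth_q, of _ 2]) (use q_ge in auto)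

lemma poly_growth_divide_q2 [poly_growth_intros]:
  assumes "poly_growth f"
  shows "poly_growth (\<lambda>t. f t / (q t)\<^sup>2)"
proof -
  have "poly_growth (\<lambda>t. f t / q t / q t)" by (intro poly_growth_intros assms)
  then show ?thesis by (simp add: power2_eq_square)
qed

lemma DERIV_q [derivative_intros]:
  "(q has_real_derivative 4 * k * t) (at t)"
  unfolding q_def[abs_def] by (auto intro!: derivative_eq_intros)

text \<open>\<open>w\<^sub>i\<^sub>j\<close> are the entries of \<^const>\<open>exc_W\<close> without the Gaussian factor,
  \<open>z\<^sub>i\<^sub>j\<close> those of \<open>X w\<close> and \<open>\<kappa>\<^sub>i\<^sub>j\<close> those of \<open>X w X\<^sup>T\<close>, where \<open>X = (P\<^sub>1')\<^sup>-\<^sup>1 P\<^sub>1\<close> has the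
  rows \<open>(t, - a/2)\<close> and \<open>(a/k, t)\<close>.\<close>

definition "w11 t = a\<^sup>2 / (4 * k) - 1 / (k * q t) - a\<^sup>2 / (q t)\<^sup>2"
definition "w12 t = - (a * t) * (1 / (k * q t) + 2 / (q t)\<^sup>2)"
definition "w22 t = 2 * (a\<^sup>2 * k + q t) / (k\<^sup>2 * (q t)\<^sup>2)"

definition "z11 t = t * (a\<^sup>2 + 2 * k / q t) / (4 * k)"
definition "z12 t = - a * (1 + k / q t) / (2 * k\<^sup>2)"
definition "z21 t = a * (1 - 2 / q t) / (4 * k)"
definition "z22 t = - t / (k * q t)"

definition "\<kappa>11 t = (a\<^sup>2 * k * t\<^sup>2 + 2 * (a\<^sup>2 - 1)) / (4 * k\<^sup>2)"
definition "\<kappa>12 t = a * t / (4 * k)"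
definition "\<kappa>22 t = 1 / (4 * k)"

text \<open>Each multiplication by \<open>X\<close> lowers the order of the pole by one:
  \<open>w\<close> has double poles at the zeros of \<open>q\<close>, \<open>X w\<close> simple
  ones, and \<open>X w X\<^sup>T\<close> none.\<close>

lemma z_eq:
  "z11 t = t * w11 t - a / 2 * w12 t" "z12 t = t * w12 t - a / 2 * w22 t"
  "z21 t = a / k * w11 t + t * w12 t" "z22 t = a / k * w12 t + t * w22 t"
  unfolding z11_def z12_def z21_def z22_def w11_def w12_def w22_def
  by (simp_all add: divide_simps power2_eq_square)
     (insert a_relation q_relation[of t], algebra+)

text \<open>The two expressions for \<open>\<kappa>12\<close> reflect the symmetry of
  \<open>X w X\<^sup>T\<close>.\<close>

lemma \<kappa>_eq:
  "\<kappa>11 t = t * z11 t - a / 2 * z12 t" "\<kappa>12 t = a / k * z11 t + t * z12 t"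
  "\<kappa>12 t = t * z21 t - a / 2 * z22 t" "\<kappa>22 t = a / k * z21 t + t * z22 t"
  unfolding z11_def z12_def z21_def z22_def \<kappa>11_def \<kappa>12_def \<kappa>22_def
  by (simp_all add: divide_simps power2_eq_square)
     (insert a_relation q_relation[of t], algebra+)

text \<open>The derivative of \<open>X w exp (- t\<^sup>2)\<close> cancels the poles of \<open>w exp (- t\<^sup>2)\<close>.\<close>

lemma DERIV_z:
  "(z11 has_real_derivative (2 * t * z11 t - w11 t + (a\<^sup>2 - 1 - a\<^sup>2 * t\<^sup>2) / (2 * k))) (at t)"
  "(z12 has_real_derivative (2 * t * z12 t - w12 t + a * t / k\<^sup>2)) (at t)"
  "(z21 has_real_derivative (2 * t * z21 t - w12 t - a * t / (2 * k))) (at t)"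
  "(z22 has_real_derivative (2 * t * z22 t - w22 t + 1 / k\<^sup>2)) (at t)"
proof -
  have 1: "(z11 has_real_derivative (a\<^sup>2 / (4 * k) + 1 / (2 * q t) - 2 * k * t\<^sup>2 / (q t)\<^sup>2)) (at t)"
    unfolding z11_def[abs_def]
    by (rule derivative_eq_intros refl | simp)+ (simp add: divide_simps power2_eq_square; algebra)
  have 2: "(z12 has_real_derivative (2 * a * t / (q t)\<^sup>2)) (at t)"
    unfolding z12_def[abs_def]
    by (rule derivative_eq_intros refl | simp)+ (simp add: divide_simps power2_eq_square power4_eq_xxxx)
  have 3: "(z21 has_real_derivative (2 * a * t / (q t)\<^sup>2)) (at t)"
    unfolding z21_def[abs_def]
    by (rule derivative_eq_intros refl | simp)+ (simp add: divide_simps power2_eq_square power4_eq_xxxx)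
  have 4: "(z22 has_real_derivative (- 1 / (k * q t) + 4 * t\<^sup>2 / (q t)\<^sup>2)) (at t)"
    unfolding z22_def[abs_def]
    by (rule derivative_eq_intros refl | simp)+ (simp add: divide_simps power2_eq_square; algebra)
  show "(z11 has_real_derivative (2 * t * z11 t - w11 t + (a\<^sup>2 - 1 - a\<^sup>2 * t\<^sup>2) / (2 * k))) (at t)"
    by (rule DERIV_cong[OF 1], unfold z11_def w11_def, simp add: divide_simps power2_eq_square)
       (insert a_relation q_relation[of t], algebra)
  show "(z12 has_real_derivative (2 * t * z12 t - w12 t + a * t / k\<^sup>2)) (at t)"
    by (rule DERIV_cong[OF 2], unfold z12_def w12_def, simp add: divide_simps power2_eq_square)
       (simp add: algebra_simps)
  show "(z21 has_real_derivative (2 * t * z21 t - w12 t - a * t / (2 * k))) (at t)"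
    by (rule DERIV_cong[OF 3], unfold z21_def w12_def, simp add: divide_simps power2_eq_square)
       (simp add: algebra_simps)
  show "(z22 has_real_derivative (2 * t * z22 t - w22 t + 1 / k\<^sup>2)) (at t)"
    by (rule DERIV_cong[OF 4], unfold z22_def w22_def, simp add: divide_simps power2_eq_square)
       (insert a_relation q_relation[of t], algebra)
qed

text \<open>\<open>X w\<close> is not symmetric, but its asymmetry is constant. Differentiating
  \<open>X w X\<^sup>T u'\<close> leaves \<open>z12\<close> where the weight produces
  \<open>z21\<close>, and vice versa; the difference is the term
  \<open>a * a\<^sup>2 / (4 * k\<^sup>2)\<close> in the second-order operator below.\<close>

lemma z_antisymmetric: "z21 t - z12 t = a * a\<^sup>2 / (4 * k\<^sup>2)"
  unfolding z21_def z12_def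
  by (simp add: divide_simps power2_eq_square) (insert a_relation q_relation[of t], algebra)

lemma poly_growth_weight [poly_growth_intros]:
  "poly_growth w11" "poly_growth w12" "poly_growth w22"
  "poly_growth z11" "poly_growth z12" "poly_growth z21" "poly_growth z22"
  "poly_growth \<kappa>11" "poly_growth \<kappa>12" "poly_growth \<kappa>22"
proof -
  have c: "poly_growth (\<lambda>t. f t / c)" if "poly_growth f" for f c
    using poly_growth_mult[OF that poly_growth_const[of "1 / c"]] by simp
  have qk: "poly_growth (\<lambda>t. f t / (k * q t))" if "poly_growth f" for f
    using c[OF poly_growth_divide_q[OF that], of k] by (simp add: ac_simps)
  have q2k: "poly_growth (\<lambda>t. f t / (k\<^sup>2 * (q t)\<^sup>2))" if "poly_growth f" for f
    using c[OF poly_growth_divide_q2[OF that], of "k\<^sup>2"] by (simp add: ac_simps)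
  note defs = w11_def[abs_def] w12_def[abs_def] w22_def[abs_def] z11_def[abs_def] z12_def[abs_def]
    z21_def[abs_def] z22_def[abs_def] \<kappa>11_def[abs_def] \<kappa>12_def[abs_def] \<kappa>22_def[abs_def]
  show "poly_growth w11" "poly_growth w12" "poly_growth w22"
    "poly_growth z11" "poly_growth z12" "poly_growth z21" "poly_growth z22"
    "poly_growth \<kappa>11" "poly_growth \<kappa>12" "poly_growth \<kappa>22"
    unfolding defs by (intro poly_growth_intros qk q2k c)+
qed

text \<open>Here \<open>u\<close> and \<open>p\<close> are rows of \<open>P\<^sub>m\<close> and \<open>P\<^sub>n\<close>, \<open>g\<close> and \<open>h\<close> the corresponding rows of the exceptional
  polynomials; the hypotheses \<open>eq1\<close>, \<open>eq2\<close> say that \<open>u\<close> is an eigenfunction of the second-order operator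
  factored by the Darboux transformation.\<close>

lemma exceptional_by_parts:
  fixes u1 u2 s1 s2 r1 r2 p1 p2 p1' p2' :: "real \<Rightarrow> real"
  defines "g1 \<equiv> \<lambda>t. - u1 t + t * s1 t + a / k * s2 t"
    and "g2 \<equiv> \<lambda>t. - u2 t - a / 2 * s1 t + t * s2 t"
    and "h1 \<equiv> \<lambda>t. - p1 t + t * p1' t + a / k * p2' t"
    and "h2 \<equiv> \<lambda>t. - p2 t - a / 2 * p1' t + t * p2' t"
    and "W1 \<equiv> \<lambda>t. (1 - a\<^sup>2 + a\<^sup>2 * t\<^sup>2) * u1 t + a * t * u2 t"
    and "W2 \<equiv> \<lambda>t. a * t * u1 t + u2 t"
  assumes u [derivative_intros]:
      "\<And>t. (u1 has_real_derivative s1 t) (at t)" "\<And>t. (u2 has_real_derivative s2 t) (at t)"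
    and s [derivative_intros]:
      "\<And>t. (s1 has_real_derivative r1 t) (at t)" "\<And>t. (s2 has_real_derivative r2 t) (at t)"
    and p [derivative_intros]:
      "\<And>t. (p1 has_real_derivative p1' t) (at t)" "\<And>t. (p2 has_real_derivative p2' t) (at t)"
    and growth: "poly_growth u1" "poly_growth u2" "poly_growth s1" "poly_growth s2"
      "poly_growth p1" "poly_growth p2" "poly_growth p1'" "poly_growth p2'"
    and eq1: "\<And>t. \<kappa>11 t * r1 t + \<kappa>12 t * r2 t
        + (a\<^sup>2 * t / (2 * k) - 2 * t * \<kappa>11 t) * s1 t
        + (a / (4 * k) - 2 * t * \<kappa>12 t + a * a\<^sup>2 / (4 * k\<^sup>2)) * s2 t
        - (a\<^sup>2 - 1 - a\<^sup>2 * t\<^sup>2) / (2 * k) * u1 t - a * t / k\<^sup>2 * u2 t = - c * W1 t"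
    and eq2: "\<And>t. \<kappa>12 t * r1 t + \<kappa>22 t * r2 t
        + (a / (4 * k) - 2 * t * \<kappa>12 t - a * a\<^sup>2 / (4 * k\<^sup>2)) * s1 t - 2 * t * \<kappa>22 t * s2 t
        + a * t / (2 * k) * u1 t - 1 / k\<^sup>2 * u2 t = - c * W2 t"
  shows "has_bochner_integral lborel (\<lambda>t. (h1 t * (w11 t * g1 t + w12 t * g2 t)
      + h2 t * (w12 t * g1 t + w22 t * g2 t) - c * (p1 t * W1 t + p2 t * W2 t)) * exp (- (t\<^sup>2))) 0"
proof -
  define V1 where "V1 t = w11 t * g1 t + w12 t * g2 t" for t
  define V2 where "V2 t = w12 t * g1 t + w22 t * g2 t" for t
  \<comment> \<open>\<open>V\<close> is the weight applied to the row \<open>g\<close>, and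
    \<open>y\<close> is \<open>X V\<close>. Writing \<open>y\<close> through \<open>\<kappa>\<close>
    and \<open>z\<close> lets \<open>DERIV_z\<close> differentiate it.\<close>
  define y1 where "y1 t = \<kappa>11 t * s1 t + \<kappa>12 t * s2 t - z11 t * u1 t - z12 t * u2 t" for t
  define y2 where "y2 t = \<kappa>12 t * s1 t + \<kappa>22 t * s2 t - z21 t * u1 t - z22 t * u2 t" for t
  have V1: "V1 t = - w11 t * u1 t - w12 t * u2 t + z11 t * s1 t + z21 t * s2 t" for t
    unfolding V1_def g1_def g2_def z_eq(1,3) by (simp add: algebra_simps)
  have V2: "V2 t = - w12 t * u1 t - w22 t * u2 t + z12 t * s1 t + z22 t * s2 t" for t
    unfolding V2_def g1_def g2_def z_eq(2,4) by (simp add: algebra_simps)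
  have y1_eq: "y1 t = t * V1 t - a / 2 * V2 t" for t
    unfolding y1_def V1 V2 \<kappa>_eq(1,3) unfolding z_eq by (simp add: algebra_simps)
  have y2_eq: "y2 t = a / k * V1 t + t * V2 t" for t
    unfolding y2_def V1 V2 \<kappa>_eq(2,4) unfolding z_eq by (simp add: algebra_simps)
  have D\<kappa> [derivative_intros]: "(\<kappa>11 has_real_derivative a\<^sup>2 * t / (2 * k)) (at t)"
      "(\<kappa>12 has_real_derivative a / (4 * k)) (at t)" "(\<kappa>22 has_real_derivative 0) (at t)" for t
    unfolding \<kappa>11_def[abs_def] \<kappa>12_def[abs_def] \<kappa>22_def[abs_def]
    by (auto intro!: derivative_eq_intros simp: divide_simps power2_eq_square)
  note DERIV_z [derivative_intros]
  \<comment> \<open>Together with \<open>D2\<close> this is the adjoint relation: the derivative of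
    \<open>y\<close> times the Gaussian is \<open>- V - c W\<close> times the Gaussian.\<close>
  have D1 [derivative_intros]: "(y1 has_real_derivative 2 * t * y1 t - V1 t - c * W1 t) (at t)" for t
    unfolding y1_def[abs_def]
    by (rule derivative_eq_intros refl)+
       (use eq1[of t] z_antisymmetric[of t] V1[of t] y1_def[of t] in algebra)
  have D2 [derivative_intros]: "(y2 has_real_derivative 2 * t * y2 t - V2 t - c * W2 t) (at t)" for t
    unfolding y2_def[abs_def]
    by (rule derivative_eq_intros refl)+
       (use eq2[of t] z_antisymmetric[of t] V2[of t] y2_def[of t] in algebra)
  \<comment> \<open>Since \<open>h = - p + p' X\<close>, the product \<open>p' y\<close> equals
    \<open>h V + p V\<close>, and \<open>p V\<close> cancels against the term \<open>- p V\<close>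
    from \<open>p y'\<close>.\<close>
  have "((\<lambda>t. (p1 t * y1 t + p2 t * y2 t) * exp (- (t\<^sup>2))) has_real_derivative
      ((h1 t * V1 t + h2 t * V2 t - c * (p1 t * W1 t + p2 t * W2 t)) * exp (- (t\<^sup>2)))) (at t)" for t
    by (rule derivative_eq_intros refl)+
       (simp add: h1_def h2_def y1_eq y2_eq algebra_simps power2_eq_square)
  moreover have "poly_growth (\<lambda>t. p1 t * y1 t + p2 t * y2 t)"
    unfolding y1_def y2_def by (intro poly_growth_intros growth)
  moreover have "poly_growth (\<lambda>t. h1 t * V1 t + h2 t * V2 t - c * (p1 t * W1 t + p2 t * W2 t))"
    unfolding V1_def V2_def h1_def h2_def g1_def g2_def W1_def W2_def
    by (intro poly_growth_intros growth)
  ultimately show ?thesis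
    unfolding V1_def V2_def by (rule has_bochner_integral_derivative_gauss)
qed

end

section \<open>Two by two matrices\<close>

lemma mat22_nth [simp]:
  "mat22 p q r s $ 1 $ 1 = of_real p" "mat22 p q r s $ 1 $ 2 = of_real q"
  "mat22 p q r s $ 2 $ 1 = of_real r" "mat22 p q r s $ 2 $ 2 = of_real s"
  by (simp_all add: mat22_def)

lemma mat22_mult: "mat22 p q r s ** mat22 p' q' r' s' =
    mat22 (p * p' + q * r') (p * q' + q * s') (r * p' + s * r') (r * q' + s * s')"
  by (simp add: vec_eq_iff forall_2 matrix_matrix_mult_def sum_2)

lemma mat22_add: "mat22 p q r s + mat22 p' q' r' s' = mat22 (p + p') (q + q') (r + r') (s + s')"
  by (simp add: vec_eq_iff forall_2)

lemma mat22_minus: "- mat22 p q r s = mat22 (- p) (- q) (- r) (- s)"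
  by (simp add: vec_eq_iff forall_2)

lemma mat22_scaleR: "c *\<^sub>R mat22 p q r s = mat22 (c * p) (c * q) (c * r) (c * s)"
  by (simp add: vec_eq_iff forall_2 complex_eq_iff)

lemma ctranspose_mat22: "ctranspose (mat22 p q r s) = mat22 p r q s"
  by (simp add: vec_eq_iff forall_2 ctranspose_def)

lemma mat22_zero: "mat22 0 0 0 0 = 0"
  by (simp add: vec_eq_iff forall_2)

lemma mat22_one: "mat22 1 0 0 1 = mat 1"
  by (simp add: vec_eq_iff forall_2 mat_def)

lemmas mat22_simps = mat22_mult mat22_add mat22_minus mat22_scaleR ctranspose_mat22

text \<open>Integrals and derivatives of matrix functions reduce through this to scalar functions
  times constant matrices.\<close>

lemma mat22_decompose: "mat22 p q r s =
    p *\<^sub>R mat22 1 0 0 0 + q *\<^sub>R mat22 0 1 0 0 + r *\<^sub>R mat22 0 0 1 0 + s *\<^sub>R mat22 0 0 0 1"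
  by (simp add: mat22_simps)

lemma has_bochner_integral_mat22:
  assumes "has_bochner_integral M f1 x1" "has_bochner_integral M f2 x2"
    "has_bochner_integral M f3 x3" "has_bochner_integral M f4 x4"
  shows "has_bochner_integral M (\<lambda>t. mat22 (f1 t) (f2 t) (f3 t) (f4 t)) (mat22 x1 x2 x3 x4)"
  unfolding mat22_decompose[of "f1 _"] mat22_decompose[of x1]
  by (intro has_bochner_integral_add has_bochner_integral_scaleR_left assms)

lemma integrable_mat22:
  assumes "integrable M f1" "integrable M f2" "integrable M f3" "integrable M f4"
  shows "integrable M (\<lambda>t. mat22 (f1 t) (f2 t) (f3 t) (f4 t))"
  by (rule integrable.intros, rule has_bochner_integral_mat22; rule has_bochner_integral_integrable[OF assms(1)]
      has_bochner_integral_integrable[OF assms(2)] has_bochner_integral_integrable[OF assms(3)]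
      has_bochner_integral_integrable[OF assms(4)])

lemma has_vector_derivative_mat22:
  assumes "(f1 has_real_derivative x1) (at t)" "(f2 has_real_derivative x2) (at t)"
    "(f3 has_real_derivative x3) (at t)" "(f4 has_real_derivative x4) (at t)"
  shows "((\<lambda>t. mat22 (f1 t) (f2 t) (f3 t) (f4 t)) has_vector_derivative mat22 x1 x2 x3 x4) (at t)"
proof -
  have *: "((\<lambda>t. f t *\<^sub>R A) has_vector_derivative x *\<^sub>R A) (at t)"
    if "(f has_real_derivative x) (at t)" for f x and A :: "complex^2^2"
    using has_vector_derivative_scaleR[OF that has_vector_derivative_const[of A]] by simp
  show ?thesis
    unfolding mat22_decompose[of "f1 _"] mat22_decompose[of x1]
    by (intro has_vector_derivative_add * assms)
qed

lemma matrix_inv_diagonal: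
  assumes "p \<noteq> 0" "s \<noteq> 0"
  shows "matrix_inv (mat22 p 0 0 s) = mat22 (1 / p) 0 0 (1 / s)"
proof -
  let ?A = "mat22 p 0 0 s" and ?B = "mat22 (1 / p) 0 0 (1 / s)"
  have AB: "?A ** ?B = mat 1" "?B ** ?A = mat 1"
    using assms by (simp_all add: mat22_simps mat22_one)
  then have "invertible ?A" by (auto simp: invertible_def)
  then have "?A ** matrix_inv ?A = mat 1"
    unfolding invertible_def matrix_inv_def by (rule someI2_ex) simp
  then have "?B ** (?A ** matrix_inv ?A) = ?B" by simp
  then show ?thesis by (simp only: matrix_mul_assoc AB matrix_mul_lid)
qed

section \<open>Entries of the polynomials and of the exceptional weight\<close>

context exceptional_weight
begin

definition "P11 n t = hermite n t"
definition "P12 n t = - a * hermite_low n t"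
definition "P22 n t = (1 - a\<^sup>2) * hermite n t + a\<^sup>2 * t * hermite_low n t"

text \<open>First and second derivatives are expressed by \<open>hermite n t\<close> and
  \<open>hermite_low n t\<close> alone, so the eigenvalue equations become polynomial identities
  with these two values as unknowns.\<close>

definition "dP11 n t = 2 * hermite_low n t"
definition "dP12 n t = - a * (2 * t * hermite_low n t - real n * hermite n t)"
definition "dP22 n t = (2 - a\<^sup>2) * hermite_low n t + a\<^sup>2 * t * (2 * t * hermite_low n t - real n * hermite n t)"

definition "ddP11 n t = 2 * (2 * t * hermite_low n t - real n * hermite n t)"
definition "ddP12 n t = - a * (2 * hermite_low n t
  + 2 * t * (2 * t * hermite_low n t - real n * hermite n t) - 2 * real n * hermite_low n t)"
definition "ddP22 n t = 2 * (2 * t * hermite_low n t - real n * hermite n t) + a\<^sup>2 * t * (2 * hermite_low n t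
  + 2 * t * (2 * t * hermite_low n t - real n * hermite n t) - 2 * real n * hermite_low n t)"

lemma DERIV_P:
  "(P11 n has_real_derivative dP11 n t) (at t)" "(P12 n has_real_derivative dP12 n t) (at t)"
  "(P22 n has_real_derivative dP22 n t) (at t)"
  "(dP11 n has_real_derivative ddP11 n t) (at t)" "(dP12 n has_real_derivative ddP12 n t) (at t)"
  "(dP22 n has_real_derivative ddP22 n t) (at t)"
  unfolding P11_def[abs_def] P12_def[abs_def] P22_def[abs_def] dP11_def[abs_def] dP12_def[abs_def]
    dP22_def[abs_def] ddP11_def ddP12_def ddP22_def
  by (auto intro!: derivative_eq_intros DERIV_hermite DERIV_hermite_low simp: algebra_simps power2_eq_square)

lemma poly_growth_P [poly_growth_intros]:
  "poly_growth (P11 n)" "poly_growth (P12 n)" "poly_growth (P22 n)"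
  "poly_growth (dP11 n)" "poly_growth (dP12 n)" "poly_growth (dP22 n)"
  unfolding P11_def[abs_def] P12_def[abs_def] P22_def[abs_def] dP11_def[abs_def] dP12_def[abs_def]
    dP22_def[abs_def]
  by (intro poly_growth_intros)+

lemma hermite_P_eq: "hermite_P a n t = mat22 (P11 n t) (P12 n t) (P12 n t) (P22 n t)"
  by (simp add: hermite_P_def mat22_simps xi_def P11_def P12_def P22_def hermite_low_def mult.commute
      algebra_simps)

lemma vector_derivative_hermite_P:
  "vector_derivative (hermite_P a n) (at t) = mat22 (dP11 n t) (dP12 n t) (dP12 n t) (dP22 n t)"
  unfolding hermite_P_eq[abs_def]
  by (intro vector_derivative_at has_vector_derivative_mat22 DERIV_P)

definition "E11 n t = - P11 n t + t * dP11 n t + a / k * dP12 n t"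
definition "E12 n t = - P12 n t - a / 2 * dP11 n t + t * dP12 n t"
definition "E21 n t = - P12 n t + t * dP12 n t + a / k * dP22 n t"
definition "E22 n t = - P22 n t - a / 2 * dP12 n t + t * dP22 n t"

lemma hermite_1: "hermite (Suc 0) t = 2 * t" and hermite_low_1: "hermite_low (Suc 0) t = 1"
  using hermite_Suc[of 0 t] by (simp_all add: hermite_low_def)

lemma exc_P_factor:
  "matrix_inv (vector_derivative (hermite_P a 1) (at t)) ** hermite_P a 1 t = mat22 t (- a / 2) (a / k) t"
proof -
  have "vector_derivative (hermite_P a 1) (at t) = mat22 2 0 0 (- k)"
    unfolding vector_derivative_hermite_P by (simp add: dP11_def dP12_def dP22_def hermite_1 hermite_low_1 k_def)
  moreover have "hermite_P a 1 t = mat22 (2 * t) (- a) (- a) (- k * t)"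
    unfolding hermite_P_eq by (simp add: P11_def P12_def P22_def hermite_1 hermite_low_1 k_def algebra_simps)
  ultimately show ?thesis
    by (simp add: matrix_inv_diagonal mat22_simps)
qed

lemma exc_P_eq: "exc_P a n t = mat22 (E11 n t) (E12 n t) (E21 n t) (E22 n t)"
  unfolding exc_P_def matrix_mul_assoc[symmetric] exc_P_factor
  unfolding vector_derivative_hermite_P hermite_P_eq
  by (simp add: mat22_simps E11_def E12_def E21_def E22_def algebra_simps)

lemma exc_W_eq: "exc_W a t = exp (- (t\<^sup>2)) *\<^sub>R mat22 (w11 t) (w12 t) (w12 t) (w22 t)"
proof -
  have p: "pfun a t = - q t" by (simp add: pfun_def q_def k_def algebra_simps)
  \<comment> \<open>Scaling by \<open>(q t)\<^sup>2\<close> clears the poles, which makes the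
    entries comparable with the stated ones.\<close>
  have e: "((q t)\<^sup>2) *\<^sub>R mat22 (w11 t) (w12 t) (w12 t) (w22 t) =
      mat22 (a\<^sup>2 / (4 * k) * (q t)\<^sup>2 - q t / k - a\<^sup>2) (a * (- q t / k - 2) * t) (a * (- q t / k - 2) * t)
       (2 * (a\<^sup>2 * k + q t) / k\<^sup>2)"
    unfolding mat22_scaleR w11_def w12_def w22_def
    by (intro arg_cong4[where f = mat22]) (simp_all add: divide_simps power2_eq_square; simp add: algebra_simps)+
  have "exc_W a t = (exp (- (t\<^sup>2)) / (q t)\<^sup>2) *\<^sub>R ((q t)\<^sup>2 *\<^sub>R mat22 (w11 t) (w12 t) (w12 t) (w22 t))"
    unfolding exc_W_def p k_def[symmetric] e by simp
  then show ?thesis by simp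
qed

end

section \<open>Orthogonality\<close>

context exceptional_weight
begin

text \<open>\<open>sform\<close> and \<open>eform\<close> pair two rows through the signed and the
  exceptional weight. The Gaussian is left outside, to match the integration by parts.\<close>

definition sform :: "real \<Rightarrow> real \<Rightarrow> real \<Rightarrow> real \<Rightarrow> real \<Rightarrow> real" where
  "sform p1 p2 u1 u2 t = p1 * ((1 - a\<^sup>2 + a\<^sup>2 * t\<^sup>2) * u1 + a * t * u2) + p2 * (a * t * u1 + u2)"

definition eform :: "real \<Rightarrow> real \<Rightarrow> real \<Rightarrow> real \<Rightarrow> real \<Rightarrow> real" where
  "eform h1 h2 g1 g2 t = h1 * (w11 t * g1 + w12 t * g2) + h2 * (w12 t * g1 + w22 t * g2)"

lemma signed_weight_eq:
  "signed_weight a (xi a) t = exp (- (t\<^sup>2)) *\<^sub>R mat22 (1 - a\<^sup>2 + a\<^sup>2 * t\<^sup>2) (a * t) (a * t) 1"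
  by (simp add: signed_weight_def xi_def mat22_simps power2_eq_square algebra_simps)

lemma sandwich_signed_weight:
  "mat22 p1 p2 r1 r2 ** signed_weight a (xi a) t ** ctranspose (mat22 u1 u2 v1 v2) =
    mat22 (sform p1 p2 u1 u2 t * exp (- (t\<^sup>2))) (sform p1 p2 v1 v2 t * exp (- (t\<^sup>2)))
      (sform r1 r2 u1 u2 t * exp (- (t\<^sup>2))) (sform r1 r2 v1 v2 t * exp (- (t\<^sup>2)))"
  unfolding signed_weight_eq mat22_simps sform_def
  by (intro arg_cong4[where f = mat22]; simp add: algebra_simps)

lemma sandwich_exc_W:
  "mat22 p1 p2 r1 r2 ** exc_W a t ** ctranspose (mat22 u1 u2 v1 v2) =
    mat22 (eform p1 p2 u1 u2 t * exp (- (t\<^sup>2))) (eform p1 p2 v1 v2 t * exp (- (t\<^sup>2)))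
      (eform r1 r2 u1 u2 t * exp (- (t\<^sup>2))) (eform r1 r2 v1 v2 t * exp (- (t\<^sup>2)))"
  unfolding exc_W_eq mat22_simps eform_def
  by (intro arg_cong4[where f = mat22]; simp add: algebra_simps)

definition "norm1 n = hermite_norm n * (1 - a\<^sup>2 + a\<^sup>2 * (real n + 1) / 2)"
definition "norm2 n = hermite_norm n * ((1 - a\<^sup>2) * (1 - a\<^sup>2 + a\<^sup>2 * real n / 2))"

text \<open>With \<open>T\<close> the triangular factor of \<^const>\<open>signed_weight\<close>, the rows of \<open>P\<^sub>n T\<close> are \<open>(H\<^sub>n, a H\<^sub>n\<^sub>+\<^sub>1 / 2)\<close>
  and \<open>(- a n H\<^sub>n\<^sub>-\<^sub>1, \<xi> H\<^sub>n)\<close>.\<close>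

lemma sform_P:
  "sform (P11 n t) (P12 n t) (P11 m t) (P12 m t) t =
     (1 - a\<^sup>2) * (hermite n t * hermite m t) + a\<^sup>2 / 4 * (hermite (Suc n) t * hermite (Suc m) t)"
  "sform (P11 n t) (P12 n t) (P12 m t) (P22 m t) t =
     a * (1 - a\<^sup>2) * (hermite (Suc n) t * hermite m t / 2 - hermite n t * hermite_low m t)"
  "sform (P12 n t) (P22 n t) (P11 m t) (P12 m t) t =
     a * (1 - a\<^sup>2) * (hermite (Suc m) t * hermite n t / 2 - hermite m t * hermite_low n t)"
  "sform (P12 n t) (P22 n t) (P12 m t) (P22 m t) t =
     (1 - a\<^sup>2) * a\<^sup>2 * (hermite_low n t * hermite_low m t) + (1 - a\<^sup>2)\<^sup>2 * (hermite n t * hermite m t)"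
  unfolding sform_def P11_def P12_def P22_def hermite_Suc by algebra+

lemma signed_inner:
  "has_bochner_integral lborel (\<lambda>t. sform (P11 n t) (P12 n t) (P11 m t) (P12 m t) t * exp (- (t\<^sup>2)))
     (if n = m then norm1 n else 0)" (is ?A)
  "has_bochner_integral lborel (\<lambda>t. sform (P11 n t) (P12 n t) (P12 m t) (P22 m t) t * exp (- (t\<^sup>2))) 0" (is ?B)
  "has_bochner_integral lborel (\<lambda>t. sform (P12 n t) (P22 n t) (P11 m t) (P12 m t) t * exp (- (t\<^sup>2))) 0" (is ?C)
  "has_bochner_integral lborel (\<lambda>t. sform (P12 n t) (P22 n t) (P12 m t) (P22 m t) t * exp (- (t\<^sup>2)))
     (if n = m then norm2 n else 0)" (is ?D)
proof -
  have "has_bochner_integral lborel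
      (\<lambda>t. (1 - a\<^sup>2) * (hermite n t * hermite m t * exp (- (t\<^sup>2)))
        + a\<^sup>2 / 4 * (hermite (Suc n) t * hermite (Suc m) t * exp (- (t\<^sup>2))))
      ((1 - a\<^sup>2) * (if n = m then hermite_norm n else 0)
        + a\<^sup>2 / 4 * (if Suc n = Suc m then hermite_norm (Suc n) else 0))"
    by (intro has_bochner_integral_add has_bochner_integral_mult_right hermite_inner)
  moreover have "(1 - a\<^sup>2) * (if n = m then hermite_norm n else 0)
        + a\<^sup>2 / 4 * (if Suc n = Suc m then hermite_norm (Suc n) else 0) = (if n = m then norm1 n else 0)"
    by (simp add: hermite_norm_Suc norm1_def field_simps)
  ultimately show ?A unfolding sform_P by (simp add: algebra_simps)
  \<comment> \<open>Both inner products are nonzero only for \<open>Suc n = m\<close>, where they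
    cancel. Exchanging \<open>n\<close> and \<open>m\<close> covers the other off-diagonal
    entry.\<close>
  have off: "has_bochner_integral lborel
      (\<lambda>t. a * (1 - a\<^sup>2) * (hermite (Suc n) t * hermite m t / 2 - hermite n t * hermite_low m t) * exp (- (t\<^sup>2))) 0"
    for n m
  proof -
    have "has_bochner_integral lborel
      (\<lambda>t. a * (1 - a\<^sup>2) * (1 / 2 * (hermite (Suc n) t * hermite m t * exp (- (t\<^sup>2)))
         - hermite n t * hermite_low m t * exp (- (t\<^sup>2))))
      (a * (1 - a\<^sup>2) * (1 / 2 * (if Suc n = m then hermite_norm (Suc n) else 0)
         - (if Suc n = m then hermite_norm m / 2 else 0)))"
      by (intro has_bochner_integral_diff has_bochner_integral_mult_right hermite_inner hermite_low_inner)
    moreover have "a * (1 - a\<^sup>2) * (1 / 2 * (if Suc n = m then hermite_norm (Suc n) else 0)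
         - (if Suc n = m then hermite_norm m / 2 else 0)) = 0"
      by auto
    ultimately show ?thesis by (simp add: algebra_simps)
  qed
  show ?B ?C unfolding sform_P by (rule off)+
  have "has_bochner_integral lborel
      (\<lambda>t. (1 - a\<^sup>2) * a\<^sup>2 * (hermite_low n t * hermite_low m t * exp (- (t\<^sup>2)))
        + (1 - a\<^sup>2)\<^sup>2 * (hermite n t * hermite m t * exp (- (t\<^sup>2))))
      ((1 - a\<^sup>2) * a\<^sup>2 * (if n = m then real n * hermite_norm n / 2 else 0)
        + (1 - a\<^sup>2)\<^sup>2 * (if n = m then hermite_norm n else 0))"
    by (intro has_bochner_integral_add has_bochner_integral_mult_right hermite_inner hermite_low_low_inner)
  moreover have "(1 - a\<^sup>2) * a\<^sup>2 * (if n = m then real n * hermite_norm n / 2 else 0)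
        + (1 - a\<^sup>2)\<^sup>2 * (if n = m then hermite_norm n else 0) = (if n = m then norm2 n else 0)"
    by (simp add: norm2_def field_simps power2_eq_square)
  ultimately show ?D unfolding sform_P by (simp add: algebra_simps)
qed

lemma signed_matrix_inner:
  "has_matrix_inner (signed_weight a (xi a)) (hermite_P a n) (hermite_P a n) (mat22 (norm1 n) 0 0 (norm2 n))"
  unfolding has_matrix_inner_def hermite_P_eq sandwich_signed_weight
  using signed_inner[of n n] by (intro has_bochner_integral_mat22) simp_all

text \<open>With \<open>eigen_row2\<close> this makes the rows of the m-th polynomial
  eigenfunctions, with \<open>c = (m - 1) / (2 * k)\<close> for the first row and
  \<open>c = - (m - 1) / k\<^sup>2\<close> for the second. These constants become the factors in the
  norm formula and vanish at \<open>m = 1\<close>.\<close>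

lemma eigen_row1:
  "\<kappa>11 t * ddP11 m t + \<kappa>12 t * ddP12 m t
    + (a\<^sup>2 * t / (2 * k) - 2 * t * \<kappa>11 t) * dP11 m t
    + (a / (4 * k) - 2 * t * \<kappa>12 t + a * a\<^sup>2 / (4 * k\<^sup>2)) * dP12 m t
    - (a\<^sup>2 - 1 - a\<^sup>2 * t\<^sup>2) / (2 * k) * P11 m t - a * t / k\<^sup>2 * P12 m t =
    - ((real m - 1) / (2 * k)) * ((1 - a\<^sup>2 + a\<^sup>2 * t\<^sup>2) * P11 m t + a * t * P12 m t)"
  "\<kappa>12 t * ddP11 m t + \<kappa>22 t * ddP12 m t
    + (a / (4 * k) - 2 * t * \<kappa>12 t - a * a\<^sup>2 / (4 * k\<^sup>2)) * dP11 m t - 2 * t * \<kappa>22 t * dP12 m t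
    + a * t / (2 * k) * P11 m t - 1 / k\<^sup>2 * P12 m t =
    - ((real m - 1) / (2 * k)) * (a * t * P11 m t + P12 m t)"
  unfolding \<kappa>11_def \<kappa>12_def \<kappa>22_def P11_def P12_def dP11_def dP12_def ddP11_def ddP12_def
  by (simp_all add: divide_simps power2_eq_square) (insert a_relation, algebra+)

lemma eigen_row2:
  "\<kappa>11 t * ddP12 m t + \<kappa>12 t * ddP22 m t
    + (a\<^sup>2 * t / (2 * k) - 2 * t * \<kappa>11 t) * dP12 m t
    + (a / (4 * k) - 2 * t * \<kappa>12 t + a * a\<^sup>2 / (4 * k\<^sup>2)) * dP22 m t
    - (a\<^sup>2 - 1 - a\<^sup>2 * t\<^sup>2) / (2 * k) * P12 m t - a * t / k\<^sup>2 * P22 m t =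
    - (- (real m - 1) / k\<^sup>2) * ((1 - a\<^sup>2 + a\<^sup>2 * t\<^sup>2) * P12 m t + a * t * P22 m t)"
  "\<kappa>12 t * ddP12 m t + \<kappa>22 t * ddP22 m t
    + (a / (4 * k) - 2 * t * \<kappa>12 t - a * a\<^sup>2 / (4 * k\<^sup>2)) * dP12 m t - 2 * t * \<kappa>22 t * dP22 m t
    + a * t / (2 * k) * P12 m t - 1 / k\<^sup>2 * P22 m t =
    - (- (real m - 1) / k\<^sup>2) * (a * t * P12 m t + P22 m t)"
  unfolding \<kappa>11_def \<kappa>12_def \<kappa>22_def P12_def P22_def dP12_def dP22_def ddP12_def ddP22_def
  by (simp_all add: divide_simps power2_eq_square) (insert a_relation, algebra+)

lemma eform_by_parts:
  assumes "has_bochner_integral lborel (\<lambda>t. (E t - c * S t) * exp (- (t\<^sup>2))) 0"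
    and "has_bochner_integral lborel (\<lambda>t. S t * exp (- (t\<^sup>2))) x"
  shows "has_bochner_integral lborel (\<lambda>t. E t * exp (- (t\<^sup>2))) (c * x)"
  using has_bochner_integral_add[OF assms(1) has_bochner_integral_mult_right[OF assms(2), of c]]
  by (simp add: algebra_simps)

text \<open>The row of index \<open>m\<close> decides the eigenvalue, the row of index
  \<open>n\<close> is the test row. The values stay unsimplified products so that they match
  \<open>eform_by_parts\<close>.\<close>

lemma exceptional_inner:
  "has_bochner_integral lborel (\<lambda>t. eform (E11 n t) (E12 n t) (E11 m t) (E12 m t) t * exp (- (t\<^sup>2)))
     ((real m - 1) / (2 * k) * (if n = m then norm1 n else 0))"
  "has_bochner_integral lborel (\<lambda>t. eform (E11 n t) (E12 n t) (E21 m t) (E22 m t) t * exp (- (t\<^sup>2)))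
     (- (real m - 1) / k\<^sup>2 * 0)"
  "has_bochner_integral lborel (\<lambda>t. eform (E21 n t) (E22 n t) (E11 m t) (E12 m t) t * exp (- (t\<^sup>2)))
     ((real m - 1) / (2 * k) * 0)"
  "has_bochner_integral lborel (\<lambda>t. eform (E21 n t) (E22 n t) (E21 m t) (E22 m t) t * exp (- (t\<^sup>2)))
     (- (real m - 1) / k\<^sup>2 * (if n = m then norm2 n else 0))"
  by (rule eform_by_parts[OF _ signed_inner(1)] eform_by_parts[OF _ signed_inner(2)]
      eform_by_parts[OF _ signed_inner(3)] eform_by_parts[OF _ signed_inner(4)],
      unfold eform_def sform_def E11_def E12_def E21_def E22_def,
      rule exceptional_by_parts[OF DERIV_P(1,2,4,5) DERIV_P(1,2) _ _ _ _ _ _ _ _ eigen_row1]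
        exceptional_by_parts[OF DERIV_P(2,3,5,6) DERIV_P(1,2) _ _ _ _ _ _ _ _ eigen_row2]
        exceptional_by_parts[OF DERIV_P(1,2,4,5) DERIV_P(2,3) _ _ _ _ _ _ _ _ eigen_row1]
        exceptional_by_parts[OF DERIV_P(2,3,5,6) DERIV_P(2,3) _ _ _ _ _ _ _ _ eigen_row2];
      intro poly_growth_intros)+

lemma exceptional_matrix_inner:
  "has_matrix_inner (exc_W a) (exc_P a n) (exc_P a m)
    (if n = m then mat22 ((real n - 1) / (2 * k) * norm1 n) 0 0 (- (real n - 1) / k\<^sup>2 * norm2 n) else 0)"
proof -
  have "has_matrix_inner (exc_W a) (exc_P a n) (exc_P a m)
    (mat22 ((real m - 1) / (2 * k) * (if n = m then norm1 n else 0)) (- (real m - 1) / k\<^sup>2 * 0)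
      ((real m - 1) / (2 * k) * 0) (- (real m - 1) / k\<^sup>2 * (if n = m then norm2 n else 0)))"
    unfolding has_matrix_inner_def exc_P_eq sandwich_exc_W
    by (intro has_bochner_integral_mat22 exceptional_inner)
  then show ?thesis by (auto simp: mat22_zero)
qed

end

section \<open>The span of the exceptional polynomials\<close>

text \<open>Supplies linearity, sum and derivative rules for the matrix product.\<close>

interpretation matrix_mult: bounded_bilinear "(**) :: complex^2^2 \<Rightarrow> complex^2^2 \<Rightarrow> complex^2^2"
proof -
  have "bilinear ((**) :: complex^2^2 \<Rightarrow> complex^2^2 \<Rightarrow> complex^2^2)"
    unfolding bilinear_def
    by (auto intro!: linearI simp: vec_eq_iff forall_2 matrix_matrix_mult_def sum_2 complex_eq_iff algebra_simps)
  then show "bounded_bilinear ((**) :: complex^2^2 \<Rightarrow> complex^2^2 \<Rightarrow> complex^2^2)"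
    by (simp add: bilinear_conv_bounded_bilinear)
qed

section \<open>Closure properties of left combinations, and antiderivatives of polynomials\<close>

lemma left_combinations_zero: "(\<lambda>t. 0) \<in> left_combinations I F"
  unfolding left_combinations_def by (auto intro!: exI[of _ "{}"])

lemma left_combinations_single:
  assumes "n \<in> I"
  shows "(\<lambda>t. C ** F n t) \<in> left_combinations I F"
  unfolding left_combinations_def using assms by (auto intro!: exI[of _ "{n}"] exI[of _ "\<lambda>_. C"])

lemma left_combinations_add:
  assumes "f \<in> left_combinations I F" "g \<in> left_combinations I F"
  shows "(\<lambda>t. f t + g t) \<in> left_combinations I F"
proof -
  obtain J C where f: "finite J" "J \<subseteq> I" "f = (\<lambda>t. \<Sum>n\<in>J. C n ** F n t)"
    using assms(1) unfolding left_combinations_def by blast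
  obtain K D where g: "finite K" "K \<subseteq> I" "g = (\<lambda>t. \<Sum>n\<in>K. D n ** F n t)"
    using assms(2) unfolding left_combinations_def by blast
  define C' D' where "C' n = (if n \<in> J then C n else 0)" and "D' n = (if n \<in> K then D n else 0)" for n
  have "f t + g t = (\<Sum>n\<in>J \<union> K. (C' n + D' n) ** F n t)" for t
  proof -
    have "f t = (\<Sum>n\<in>J \<union> K. C' n ** F n t)"
      unfolding f(3) using f(1) g(1) by (intro sum.mono_neutral_cong_left) (auto simp: C'_def)
    moreover have "g t = (\<Sum>n\<in>J \<union> K. D' n ** F n t)"
      unfolding g(3) using f(1) g(1) by (intro sum.mono_neutral_cong_left) (auto simp: D'_def)
    ultimately show ?thesis by (simp add: matrix_mult.add_left sum.distrib)
  qed
  then show ?thesis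
    unfolding left_combinations_def using f(1,2) g(1,2)
    by (intro CollectI exI[of _ "J \<union> K"] exI[of _ "\<lambda>n. C' n + D' n"]) auto
qed

lemma left_combinations_sum:
  assumes "\<And>i. i \<in> A \<Longrightarrow> f i \<in> left_combinations I F"
  shows "(\<lambda>t. \<Sum>i\<in>A. f i t) \<in> left_combinations I F"
  using assms
  by (induction A rule: infinite_finite_induct) (auto intro: left_combinations_zero left_combinations_add)

lemma pderiv_surj:
  fixes s :: "real poly"
  obtains p where "pderiv p = s"
proof -
  define p where "p = (\<Sum>i\<le>degree s. monom (coeff s i / real (Suc i)) (Suc i))"
  have "pderiv p = (\<Sum>i\<le>degree s. pderiv (monom (coeff s i / real (Suc i)) (Suc i)))"
    unfolding p_def using higher_pderiv_sum[of 1] by simp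
  also have "\<dots> = (\<Sum>i\<le>degree s. monom (coeff s i) i)"
    by (intro sum.cong refl) (simp add: pderiv_monom del: of_nat_Suc)
  also have "\<dots> = s" by (rule poly_as_sum_of_monoms)
  finally show ?thesis by (rule that)
qed

context exceptional_weight
begin

text \<open>A leading coefficient of \<open>hermite_P a n\<close> up to \<open>2 ^ n\<close>. It is
  at least 1 for \<open>n \<ge> 2\<close>, and equals \<open>1 - a\<^sup>2\<close> or
  \<open>1 - a\<^sup>2 / 2\<close>, both negative, for \<open>n = 0, 1\<close>.\<close>

lemma lead_nonzero: "1 - a\<^sup>2 + a\<^sup>2 * real n / 2 \<noteq> 0"
proof (cases "n \<ge> 2")
  case True
  then have "a\<^sup>2 * 2 \<le> a\<^sup>2 * real n" by (intro mult_left_mono) auto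
  then show ?thesis by linarith
next
  case False
  then have "n = 0 \<or> n = 1" by linarith
  then show ?thesis using a_sq by auto
qed

text \<open>The off-diagonal entries have no term of degree \<open>n\<close>, while
  \<open>t * hermite_low n t\<close> in the last entry contributes \<open>2 ^ n * n / 2\<close> to
  its leading coefficient.\<close>

lemma hermite_P_expansion:
  obtains M where "\<And>t. hermite_P a n t = (\<Sum>i\<le>n. t ^ i *\<^sub>R M i)"
    "M n = 2 ^ n *\<^sub>R mat22 1 0 0 (1 - a\<^sup>2 + a\<^sup>2 * real n / 2)"
proof -
  define g where "g = smult (real n) (hermite_poly (n - 1))"
  define p22 where "p22 = smult (1 - a\<^sup>2) (hermite_poly n) + smult (a\<^sup>2) (pCons 0 g)"
  define M where "M i = mat22 (coeff (hermite_poly n) i) (- a * coeff g i) (- a * coeff g i) (coeff p22 i)" for i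
  have deg_g: "degree g \<le> n" "degree (pCons 0 g) \<le> n" "coeff g n = 0"
  proof -
    have 1: "degree g \<le> n - 1" unfolding g_def
      using degree_hermite_poly[of "n - 1"] degree_smult_le order_trans by blast
    then show "degree g \<le> n" by simp
    show "degree (pCons 0 g) \<le> n"
    proof (cases n)
      case 0
      then have "g = 0" by (simp add: g_def)
      then show ?thesis by simp
    qed (use 1 degree_pCons_le[of 0 g] in simp)
    show "coeff g n = 0"
    proof (cases n)
      case (Suc m)
      then show ?thesis using 1 by (intro coeff_eq_0) simp
    qed (simp add: g_def)
  qed
  have deg22: "degree p22 \<le> n"
    unfolding p22_def using deg_g(2) degree_hermite_poly[of n]
    by (intro degree_add_le order_trans[OF degree_smult_le])
  have ev: "poly p t = (\<Sum>i\<le>n. t ^ i * coeff p i)" if "degree p \<le> n" for p :: "real poly" and t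
    using poly_altdef[of p t] that
    by (simp add: mult.commute sum.mono_neutral_left[of "{..n}" "{..degree p}"] coeff_eq_0)
  have low: "hermite_low n t = poly g t" for t by (simp add: g_def hermite_low_def hermite_eq_poly)
  have "hermite_P a n t = (\<Sum>i\<le>n. t ^ i *\<^sub>R M i)" for t
  proof -
    have "(\<Sum>i\<le>n. t ^ i *\<^sub>R mat22 (f1 i) (f2 i) (f3 i) (f4 i)) =
       mat22 (\<Sum>i\<le>n. t ^ i * f1 i) (\<Sum>i\<le>n. t ^ i * f2 i) (\<Sum>i\<le>n. t ^ i * f3 i) (\<Sum>i\<le>n. t ^ i * f4 i)"
      for f1 f2 f3 f4 by (simp add: mat22_scaleR vec_eq_iff forall_2)
    then have "(\<Sum>i\<le>n. t ^ i *\<^sub>R M i) =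
        mat22 (poly (hermite_poly n) t) (- a * poly g t) (- a * poly g t) (poly p22 t)"
      unfolding M_def ev[OF degree_hermite_poly] ev[OF deg_g(1)] ev[OF deg22]
      by (simp add: sum_distrib_left sum_negf ac_simps)
    then show ?thesis
      unfolding hermite_P_eq P11_def P12_def P22_def low
      by (simp add: hermite_eq_poly p22_def algebra_simps)
  qed
  moreover have "M n = 2 ^ n *\<^sub>R mat22 1 0 0 (1 - a\<^sup>2 + a\<^sup>2 * real n / 2)"
  proof -
    have "coeff (pCons 0 g) n = 2 ^ n * (real n / 2)"
      by (cases n) (simp_all add: g_def coeff_hermite_poly)
    then have "coeff p22 n = 2 ^ n * (1 - a\<^sup>2 + a\<^sup>2 * real n / 2)"
      unfolding p22_def coeff_add coeff_smult by (simp add: coeff_hermite_poly algebra_simps)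
    then show ?thesis
      unfolding M_def using deg_g(3) by (simp add: coeff_hermite_poly mat22_scaleR)
  qed
  ultimately show ?thesis by (rule that)
qed

text \<open>Triangular elimination: the leading coefficient is invertible, and the lower powers are
  removed by induction.\<close>

lemma monomial_in_span: "(\<lambda>t. t ^ n *\<^sub>R B) \<in> left_combinations UNIV (hermite_P a)"
proof (induction n arbitrary: B rule: less_induct)
  case (less n)
  obtain M where M: "\<And>t. hermite_P a n t = (\<Sum>i\<le>n. t ^ i *\<^sub>R M i)"
    "M n = 2 ^ n *\<^sub>R mat22 1 0 0 (1 - a\<^sup>2 + a\<^sup>2 * real n / 2)"
    using hermite_P_expansion[of n] by blast
  define C where "C = B ** ((1 / 2 ^ n) *\<^sub>R mat22 1 0 0 (1 / (1 - a\<^sup>2 + a\<^sup>2 * real n / 2)))"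
  have C: "C ** M n = B"
    unfolding C_def M(2) matrix_mul_assoc[symmetric] matrix_mult.scaleR_left matrix_mult.scaleR_right
    by (simp add: mat22_mult lead_nonzero mat22_one)
  have "(\<lambda>t. C ** hermite_P a n t + (\<Sum>i<n. t ^ i *\<^sub>R (- (C ** M i)))) \<in> left_combinations UNIV (hermite_P a)"
    by (intro left_combinations_add left_combinations_single left_combinations_sum less.IH) auto
  moreover have "C ** hermite_P a n t + (\<Sum>i<n. t ^ i *\<^sub>R (- (C ** M i))) = t ^ n *\<^sub>R B" for t
    unfolding M(1) matrix_mult.sum_right lessThan_Suc_atMost[symmetric]
    by (simp add: matrix_mult.scaleR_right C sum_negf)
  ultimately show ?case by simp
qed

lemma poly_in_span: "(\<lambda>t. poly r t *\<^sub>R B) \<in> left_combinations UNIV (hermite_P a)"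
proof -
  have "(\<lambda>t. \<Sum>i\<le>degree r. t ^ i *\<^sub>R (coeff r i *\<^sub>R B)) \<in> left_combinations UNIV (hermite_P a)"
    by (intro left_combinations_sum monomial_in_span)
  then show ?thesis by (simp add: poly_altdef scaleR_sum_left mult.commute)
qed

lemma darboux_in_span:
  assumes "Q \<in> left_combinations UNIV (hermite_P a)"
    and deriv: "\<And>t. (Q has_vector_derivative Q' t) (at t)"
  shows "(\<lambda>t. - Q t + Q' t ** mat22 t (- a / 2) (a / k) t) \<in> left_combinations {n. n \<noteq> 1} (exc_P a)"
proof -
  obtain J C where J: "finite J" and Q: "Q = (\<lambda>t. \<Sum>n\<in>J. C n ** hermite_P a n t)"
    using assms(1) unfolding left_combinations_def by blast
  define P' where "P' n t = mat22 (dP11 n t) (dP12 n t) (dP12 n t) (dP22 n t)" for n t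
  have "(hermite_P a n has_vector_derivative P' n t) (at t)" for n t
    unfolding hermite_P_eq[abs_def] P'_def by (intro has_vector_derivative_mat22 DERIV_P)
  then have "(Q has_vector_derivative (\<Sum>n\<in>J. C n ** P' n t)) (at t)" for t
    unfolding Q by (intro has_vector_derivative_sum bounded_linear.has_vector_derivative[OF matrix_mult.bounded_linear_right])
  then have Q': "Q' t = (\<Sum>n\<in>J. C n ** P' n t)" for t
    using deriv[of t] vector_derivative_unique_at by blast
  have exc: "exc_P a n t = - hermite_P a n t + P' n t ** mat22 t (- a / 2) (a / k) t" for n t
    unfolding exc_P_def matrix_mul_assoc[symmetric] exc_P_factor
    unfolding vector_derivative_hermite_P P'_def ..
  have exc1: "exc_P a (Suc 0) t = 0" for t
    unfolding exc_P_eq by (simp add: E11_def E12_def E21_def E22_def P11_def P12_def P22_def dP11_def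
        dP12_def dP22_def hermite_1 hermite_low_1 mat22_zero[symmetric] divide_simps)
      (use a_relation in \<open>simp add: power2_eq_square algebra_simps\<close>)
  have "- Q t + Q' t ** mat22 t (- a / 2) (a / k) t = (\<Sum>n\<in>J. C n ** exc_P a n t)" for t
    unfolding Q Q' exc matrix_mult.sum_left matrix_mult.add_right matrix_mult.minus_right sum.distrib sum_negf
    by (simp add: matrix_mul_assoc)
  also have "(\<Sum>n\<in>J. C n ** exc_P a n t) = (\<Sum>n\<in>J - {1}. C n ** exc_P a n t)" for t
    using J by (intro sum.mono_neutral_right) (auto simp: exc1)
  finally show ?thesis
    unfolding left_combinations_def using J by (intro CollectI exI[of _ "J - {1}"] exI[of _ C]) auto
qed

text \<open>If \<open>R' = Q\<^sub>1' X\<close> then \<open>Q = Q\<^sub>1 X - R\<close> satisfies \<open>Q' = Q\<^sub>1\<close>, because \<open>X' = 1\<close>, and hence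
  \<open>- Q + Q' X = R\<close>. For \<open>R = q\<^sup>2 r B\<close> a polynomial \<open>Q\<^sub>1\<close> exists since \<open>q\<close> divides \<open>R'\<close> and
  \<open>det X = q / (2 k)\<close>.\<close>

lemma multiple_in_span:
  "(\<lambda>t. ((q t)\<^sup>2 * poly r t) *\<^sub>R B) \<in> left_combinations {n. n \<noteq> 1} (exc_P a)"
proof -
  define qp where "qp = [:a\<^sup>2, 0, 2 * k:]"
  have qp: "poly qp t = q t" for t by (simp add: qp_def q_def power2_eq_square algebra_simps)
  define \<sigma> where "\<sigma> = pderiv qp * r + pderiv qp * r + qp * pderiv r"
  \<comment> \<open>The factorization \<open>(t - N) (t + N) = q / (2 k)\<close>, with
    \<open>X = t + N\<close>, dictates the choice: \<open>Q1' = 2 k \<sigma> B (t - N)\<close> gives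
    \<open>Q1' X = q \<sigma> B\<close>, the derivative of \<open>\<rho> B\<close>.\<close>
  obtain \<tau>0 where \<tau>0: "pderiv \<tau>0 = smult (2 * k) \<sigma>" by (rule pderiv_surj)
  obtain \<tau>1 where \<tau>1: "pderiv \<tau>1 = smult (2 * k) (pCons 0 \<sigma>)" by (rule pderiv_surj)
  define N where "N = mat22 0 (- a / 2) (a / k) 0"
  define \<rho> where "\<rho> = qp * qp * r"
  have \<rho>': "pderiv \<rho> = qp * \<sigma>"
    unfolding \<rho>_def \<sigma>_def by (simp add: pderiv_mult algebra_simps)
  \<comment> \<open>\<open>c1\<close> and \<open>c2\<close> are the coordinates of
    \<open>Q1 X - \<rho> B\<close> along \<open>B\<close> and \<open>B N\<close>, after
    \<open>N N\<close> is replaced by its scalar value.\<close>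
  define c1 where "c1 = pCons 0 \<tau>1 - \<rho> + smult (a\<^sup>2 / (2 * k)) \<tau>0"
  define c2 where "c2 = \<tau>1 - pCons 0 \<tau>0"
  define Q where "Q t = poly c1 t *\<^sub>R B + poly c2 t *\<^sub>R (B ** N)" for t
  define Q1 where "Q1 t = poly \<tau>1 t *\<^sub>R B + poly (- \<tau>0) t *\<^sub>R (B ** N)" for t
  have NN: "N ** N = (- (a\<^sup>2 / (2 * k))) *\<^sub>R mat 1"
    by (simp add: N_def mat22_simps mat22_one[symmetric] power2_eq_square mult.commute)
  have X: "mat22 t (- a / 2) (a / k) t = t *\<^sub>R mat 1 + N" for t
    by (simp add: N_def mat22_simps mat22_one[symmetric])
  have "Q \<in> left_combinations UNIV (hermite_P a)"
    unfolding Q_def[abs_def] by (intro left_combinations_add poly_in_span)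
  moreover have "(Q has_vector_derivative Q1 t) (at t)" for t
  proof -
    have d: "((\<lambda>t. poly p t *\<^sub>R A) has_vector_derivative poly (pderiv p) t *\<^sub>R A) (at t)"
      for p and A :: "complex^2^2"
      using has_vector_derivative_scaleR[OF poly_DERIV[of p t] has_vector_derivative_const[of A]] by simp
    have "poly (pderiv c1) t = poly \<tau>1 t"
      unfolding c1_def by (simp add: pderiv_pCons pderiv_diff pderiv_add pderiv_smult \<tau>0 \<tau>1 \<rho>' qp q_def
          power2_eq_square algebra_simps)
    moreover have "poly (pderiv c2) t = poly (- \<tau>0) t"
      unfolding c2_def by (simp add: pderiv_pCons pderiv_diff \<tau>0 \<tau>1)
    ultimately show ?thesis
      unfolding Q_def[abs_def] Q1_def using has_vector_derivative_add[OF d[of c1 B] d[of c2 "B ** N"]] by simp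
  qed
  ultimately have "(\<lambda>t. - Q t + Q1 t ** mat22 t (- a / 2) (a / k) t) \<in> left_combinations {n. n \<noteq> 1} (exc_P a)"
    by (rule darboux_in_span)
  moreover have "- Q t + Q1 t ** mat22 t (- a / 2) (a / k) t = ((q t)\<^sup>2 * poly r t) *\<^sub>R B" for t
  proof -
    have "Q1 t ** mat22 t (- a / 2) (a / k) t = (t * poly \<tau>1 t + a\<^sup>2 / (2 * k) * poly \<tau>0 t) *\<^sub>R B
        + (poly \<tau>1 t - t * poly \<tau>0 t) *\<^sub>R (B ** N)"
      unfolding X Q1_def
      by (simp add: matrix_mult.add_right matrix_mult.add_left matrix_mult.diff_left matrix_mult.minus_right matrix_mult.scaleR_left
          matrix_mult.scaleR_right matrix_mul_assoc[symmetric] NN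
          algebra_simps matrix_mul_rid)
    then show ?thesis
      unfolding Q_def c1_def c2_def \<rho>_def by (simp add: qp power2_eq_square algebra_simps)
  qed
  ultimately show ?thesis by simp
qed

end

section \<open>Positivity and density\<close>

text \<open>The Hermitian form of the real symmetric matrix with rows \<open>(p, q)\<close> and
  \<open>(q, s)\<close> at the complex vector \<open>(x, y)\<close>, in real coordinates.\<close>

definition cform :: "real \<Rightarrow> real \<Rightarrow> real \<Rightarrow> complex \<Rightarrow> complex \<Rightarrow> real" where
  "cform p q s x y = p * ((Re x)\<^sup>2 + (Im x)\<^sup>2) + 2 * q * (Re x * Re y + Im x * Im y) + s * ((Re y)\<^sup>2 + (Im y)\<^sup>2)"

text \<open>Multiplying by \<open>p\<close> and completing the square leaves the determinant as the
  coefficient of the last squared modulus.\<close>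

lemma cform_pos:
  assumes "p > 0" "p * s - q\<^sup>2 > 0" "x \<noteq> 0 \<or> y \<noteq> 0"
  shows "cform p q s x y > 0"
proof -
  have eq: "p * cform p q s x y = (p * Re x + q * Re y)\<^sup>2 + (p * Im x + q * Im y)\<^sup>2
      + (p * s - q\<^sup>2) * ((Re y)\<^sup>2 + (Im y)\<^sup>2)"
    unfolding cform_def by (simp add: power2_eq_square algebra_simps)
  have "p * cform p q s x y > 0"
  proof (cases "y = 0")
    case True
    then have "(Re x)\<^sup>2 + (Im x)\<^sup>2 > 0"
      using assms(3) by (simp add: sum_power2_gt_zero_iff complex_eq_iff)
    moreover have "p * cform p q s x y = p\<^sup>2 * ((Re x)\<^sup>2 + (Im x)\<^sup>2)"
      unfolding eq using True by (simp add: power2_eq_square algebra_simps)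
    ultimately show ?thesis using assms(1) by simp
  next
    case False
    then have "(p * s - q\<^sup>2) * ((Re y)\<^sup>2 + (Im y)\<^sup>2) > 0"
      using assms(2) by (simp add: sum_power2_gt_zero_iff complex_eq_iff)
    moreover have "(p * Re x + q * Re y)\<^sup>2 + (p * Im x + q * Im y)\<^sup>2 \<ge> 0" by simp
    ultimately show ?thesis unfolding eq by linarith
  qed
  then show ?thesis using assms(1) by (simp add: zero_less_mult_iff)
qed

lemma cform_nonneg:
  assumes "p > 0" "p * s - q\<^sup>2 > 0"
  shows "cform p q s x y \<ge> 0"
proof (cases "x = 0 \<and> y = 0")
  case False
  then show ?thesis using cform_pos[OF assms] less_imp_le by blast
qed (simp add: cform_def)

text \<open>The trace bounds the form: the defect is the same form at the rotated vector
  \<open>(y, - x)\<close>.\<close>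

lemma cform_le:
  assumes "p > 0" "p * s - q\<^sup>2 > 0"
  shows "cform p q s x y \<le> (p + s) * ((cmod x)\<^sup>2 + (cmod y)\<^sup>2)"
proof -
  have "cform p q s x y = (p + s) * ((cmod x)\<^sup>2 + (cmod y)\<^sup>2) - cform p q s y (- x)"
    unfolding cform_def cmod_power2 by (simp add: algebra_simps)
  then show ?thesis using cform_nonneg[OF assms, of y "- x"] by linarith
qed

text \<open>Parallelogram law with the form of the difference discarded.\<close>

lemma cform_add_le:
  assumes "p > 0" "p * s - q\<^sup>2 > 0"
  shows "cform p q s (x + x') (y + y') \<le> 2 * cform p q s x y + 2 * cform p q s x' y'"
proof -
  have "cform p q s (x + x') (y + y') =
      2 * cform p q s x y + 2 * cform p q s x' y' - cform p q s (x - x') (y - y')"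
    unfolding cform_def by (simp add: power2_eq_square algebra_simps)
  then show ?thesis using cform_nonneg[OF assms, of "x - x'" "y - y'"] by linarith
qed

lemma positive_definite_mat22:
  assumes "p > 0" "p * s - q\<^sup>2 > 0"
  shows "positive_definite (mat22 p q q s)"
  unfolding positive_definite_def
proof (intro conjI allI impI)
  show "ctranspose (mat22 p q q s) = mat22 p q q s" by (rule ctranspose_mat22)
  fix v :: "complex^2" assume "v \<noteq> 0"
  then have "v $ 1 \<noteq> 0 \<or> v $ 2 \<noteq> 0" by (simp add: vec_eq_iff forall_2)
  from cform_pos[OF assms this]
  show "0 < Re (\<Sum>i\<in>UNIV. cnj (v $ i) * (mat22 p q q s *v v) $ i)"
    by (simp add: sum_2 matrix_vector_mult_def cform_def power2_eq_square algebra_simps)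
qed

lemma norm_matrix_sq:
  fixes A :: "complex^2^2"
  shows "(norm A)\<^sup>2 = (cmod (A $ 1 $ 1))\<^sup>2 + (cmod (A $ 1 $ 2))\<^sup>2 + (cmod (A $ 2 $ 1))\<^sup>2 + (cmod (A $ 2 $ 2))\<^sup>2"
  unfolding norm_vec_def L2_set_def by (simp add: sum_2 real_sqrt_pow2 add.assoc)

lemma trace_sandwich:
  "Re (trace (A ** (c *\<^sub>R mat22 p q q s) ** ctranspose A)) =
    c * (cform p q s (A $ 1 $ 1) (A $ 1 $ 2) + cform p q s (A $ 2 $ 1) (A $ 2 $ 2))"
  unfolding mat22_scaleR
  by (simp add: trace_def sum_2 matrix_matrix_mult_def ctranspose_def cform_def power2_eq_square algebra_simps)

section \<open>Matrix functions of polynomial growth\<close>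

definition matrix_growth :: "(real \<Rightarrow> complex^2^2) \<Rightarrow> bool" where
  "matrix_growth F \<longleftrightarrow> (\<forall>i j. poly_growth (\<lambda>t. Re (F t $ i $ j)) \<and> poly_growth (\<lambda>t. Im (F t $ i $ j)))"

lemma matrix_growth_mat22:
  assumes "poly_growth f1" "poly_growth f2" "poly_growth f3" "poly_growth f4"
  shows "matrix_growth (\<lambda>t. mat22 (f1 t) (f2 t) (f3 t) (f4 t))"
  using assms unfolding matrix_growth_def forall_2 by (simp add: poly_growth_const)

lemma matrix_growth_mult_left:
  assumes "matrix_growth F"
  shows "matrix_growth (\<lambda>t. C ** F t)"
  using assms unfolding matrix_growth_def
  by (auto simp: matrix_matrix_mult_def sum_2 intro!: poly_growth_intros)

lemma matrix_growth_sum: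
  assumes "\<And>i. i \<in> A \<Longrightarrow> matrix_growth (F i)"
  shows "matrix_growth (\<lambda>t. \<Sum>i\<in>A. F i t)"
  using assms unfolding matrix_growth_def by (auto intro!: poly_growth_intros)

lemma matrix_growth_measurable:
  assumes "matrix_growth F"
  shows "F \<in> borel_measurable borel"
proof -
  have "continuous_on UNIV (\<lambda>t. F t $ i $ j)" for i j
  proof -
    have "continuous_on UNIV (\<lambda>t. Complex (Re (F t $ i $ j)) (Im (F t $ i $ j)))"
      using assms unfolding matrix_growth_def
      by (intro continuous_on_Complex poly_growth_continuous) auto
    then show ?thesis by simp
  qed
  then have "continuous_on UNIV F"
    by (intro continuous_on_vec_lambda[of UNIV "\<lambda>i t. F t $ i", simplified]
        continuous_on_vec_lambda[of UNIV "\<lambda>j t. F t $ _ $ j", simplified])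
  then show ?thesis by (rule borel_measurable_continuous_onI)
qed

context exceptional_weight
begin

text \<open>The determinant simplifies to \<open>(k + 1) / (2 * k * (q t)\<^sup>2)\<close>. Since
  \<open>w22\<close> is visibly positive, positivity of the determinant forces that of
  \<open>w11\<close>.\<close>

lemma weight_pos: "w11 t > 0" "w11 t * w22 t - (w12 t)\<^sup>2 > 0"
proof -
  have det: "w11 t * w22 t - (w12 t)\<^sup>2 = (k + 1) / (2 * k * (q t)\<^sup>2)"
    unfolding w11_def w12_def w22_def
    by (simp add: divide_simps power2_eq_square) (insert a_relation q_relation[of t], algebra)
  show d: "w11 t * w22 t - (w12 t)\<^sup>2 > 0"
    unfolding det using k_pos q_pos[of t] by simp
  have "w22 t > 0"
    unfolding w22_def using k_pos q_pos[of t] a_sq by (intro divide_pos_pos mult_pos_pos add_pos_pos) auto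
  moreover have "w11 t * w22 t > 0" using d zero_le_power2[of "w12 t"] by linarith
  ultimately show "w11 t > 0" by (simp add: zero_less_mult_iff)
qed

lemma positive_definite_exc_W: "positive_definite (exc_W a t)"
proof -
  have "positive_definite (mat22 (e * w11 t) (e * w12 t) (e * w12 t) (e * w22 t))" if "e > 0" for e
  proof (rule positive_definite_mat22)
    show "e * w11 t > 0" using that weight_pos by simp
    have "e * w11 t * (e * w22 t) - (e * w12 t)\<^sup>2 = e\<^sup>2 * (w11 t * w22 t - (w12 t)\<^sup>2)"
      by (simp add: power2_eq_square algebra_simps)
    then show "e * w11 t * (e * w22 t) - (e * w12 t)\<^sup>2 > 0"
      using that weight_pos[of t] by simp
  qed
  then show ?thesis unfolding exc_W_eq mat22_scaleR by simp
qed

lemma weight_matrix_exc_W: "weight_matrix (exc_W a)"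
  unfolding weight_matrix_def
proof (intro conjI allI)
  show "AE t in lborel. positive_definite (exc_W a t)" using positive_definite_exc_W by simp
  fix n :: nat
  have i: "integrable lborel (\<lambda>t. t ^ n * (exp (- (t\<^sup>2)) * f t))" if "poly_growth f" for f
  proof -
    have "integrable lborel (\<lambda>t. (t ^ n * f t) * exp (- (t\<^sup>2)))"
      by (intro integrable_poly_growth_gauss poly_growth_intros that)
    then show ?thesis by (simp add: ac_simps)
  qed
  show "integrable lborel (\<lambda>t. (t ^ n) *\<^sub>R exc_W a t)"
    unfolding exc_W_eq mat22_scaleR
    by (intro integrable_mat22 i poly_growth_intros)
qed

section \<open>The integrand of the squared norm, and approximation in the weighted space\<close>

definition wnorm :: "real \<Rightarrow> complex^2^2 \<Rightarrow> real" where
  "wnorm t A = Re (trace (A ** exc_W a t ** ctranspose A))"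

lemma wnorm_eq: "wnorm t A = exp (- (t\<^sup>2)) *
    (cform (w11 t) (w12 t) (w22 t) (A $ 1 $ 1) (A $ 1 $ 2) + cform (w11 t) (w12 t) (w22 t) (A $ 2 $ 1) (A $ 2 $ 2))"
  unfolding wnorm_def exc_W_eq by (rule trace_sandwich)

lemma wnorm_nonneg: "wnorm t A \<ge> 0"
  unfolding wnorm_eq by (intro mult_nonneg_nonneg add_nonneg_nonneg cform_nonneg weight_pos) auto

lemma wnorm_le: "wnorm t A \<le> exp (- (t\<^sup>2)) * ((w11 t + w22 t) * (norm A)\<^sup>2)"
  unfolding wnorm_eq norm_matrix_sq
  using cform_le[OF weight_pos, of t "A $ 1 $ 1" "A $ 1 $ 2"] cform_le[OF weight_pos, of t "A $ 2 $ 1" "A $ 2 $ 2"]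
  by (intro mult_left_mono) (auto simp: algebra_simps)

lemma wnorm_add_le: "wnorm t (A + B) \<le> 2 * wnorm t A + 2 * wnorm t B"
proof -
  let ?c = "cform (w11 t) (w12 t) (w22 t)"
  have "?c (A $ 1 $ 1 + B $ 1 $ 1) (A $ 1 $ 2 + B $ 1 $ 2) + ?c (A $ 2 $ 1 + B $ 2 $ 1) (A $ 2 $ 2 + B $ 2 $ 2)
    \<le> 2 * (?c (A $ 1 $ 1) (A $ 1 $ 2) + ?c (A $ 2 $ 1) (A $ 2 $ 2))
      + 2 * (?c (B $ 1 $ 1) (B $ 1 $ 2) + ?c (B $ 2 $ 1) (B $ 2 $ 2))"
    unfolding distrib_left
    by (rule order_trans[OF add_mono[OF cform_add_le[OF weight_pos] cform_add_le[OF weight_pos]]]) simp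
  from mult_left_mono[OF this, of "exp (- (t\<^sup>2))"]
  show ?thesis unfolding wnorm_eq by (simp add: algebra_simps)
qed

lemma wnorm_measurable:
  assumes [measurable]: "f \<in> borel_measurable borel"
  shows "(\<lambda>t. wnorm t (f t)) \<in> borel_measurable borel"
proof -
  have c [measurable]: "(\<lambda>t. f t $ i $ j) \<in> borel_measurable borel" for i j
  proof -
    have "continuous_on UNIV (\<lambda>A :: complex^2^2. A $ i $ j)" by (intro continuous_intros)
    from borel_measurable_continuous_onI[OF this] assms
    show ?thesis by (rule measurable_compose_rev)
  qed
  note [measurable] = poly_growth_measurable[OF poly_growth_weight(1)]
    poly_growth_measurable[OF poly_growth_weight(2)] poly_growth_measurable[OF poly_growth_weight(3)]
  show ?thesis unfolding wnorm_eq cform_def by measurable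
qed

lemma matrix_growth_L2:
  assumes "matrix_growth F"
  shows "F \<in> L2 (exc_W a)"
proof -
  have "poly_growth (\<lambda>t. (w11 t + w22 t) * (norm (F t))\<^sup>2)"
    using assms unfolding matrix_growth_def norm_matrix_sq cmod_power2
    by (intro poly_growth_intros) auto
  then have "integrable lborel (\<lambda>t. (w11 t + w22 t) * (norm (F t))\<^sup>2 * exp (- (t\<^sup>2)))"
    by (rule integrable_poly_growth_gauss)
  then have "integrable lborel (\<lambda>t. wnorm t (F t))"
  proof (rule Bochner_Integration.integrable_bound)
    show "(\<lambda>t. wnorm t (F t)) \<in> borel_measurable lborel"
      using wnorm_measurable[OF matrix_growth_measurable[OF assms]] by simp
    have "norm (wnorm t (F t)) \<le> norm ((w11 t + w22 t) * (norm (F t))\<^sup>2 * exp (- (t\<^sup>2)))" for t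
    proof -
      have "norm (wnorm t (F t)) = wnorm t (F t)" using wnorm_nonneg[of t "F t"] by simp
      also have "\<dots> \<le> (w11 t + w22 t) * (norm (F t))\<^sup>2 * exp (- (t\<^sup>2))"
        using wnorm_le[of t "F t"] by (simp add: ac_simps)
      also have "\<dots> \<le> norm \<dots>" unfolding real_norm_def by (rule abs_ge_self)
      finally show ?thesis .
    qed
    then show "AE t in lborel. norm (wnorm t (F t)) \<le> norm ((w11 t + w22 t) * (norm (F t))\<^sup>2 * exp (- (t\<^sup>2)))"
      by (intro AE_I2)
  qed
  then show ?thesis
    using matrix_growth_measurable[OF assms] by (simp add: L2_def wnorm_def)
qed

lemma left_combinations_growth:
  assumes "g \<in> left_combinations I (exc_P a)"
  shows "matrix_growth g"
proof -
  have "matrix_growth (exc_P a n)" for n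
    unfolding exc_P_eq[abs_def] E11_def E12_def E21_def E22_def
    by (intro matrix_growth_mat22 poly_growth_intros)
  then show ?thesis
    using assms unfolding left_combinations_def
    by (auto intro!: matrix_growth_sum matrix_growth_mult_left)
qed

text \<open>Polynomials approximate \<open>f / q\<^sup>2\<close> coordinatewise and are multiplied
  back by \<open>q\<^sup>2\<close>, which puts them into the span by
  \<open>multiple_in_span\<close>. The squared error then carries \<open>q ^ 4\<close> times the
  weight, dominated by the half Gaussian.\<close>

lemma bounded_approximation:
  fixes f :: "real \<Rightarrow> complex^2^2"
  assumes f [measurable]: "f \<in> borel_measurable borel" and M: "\<And>t. norm (f t) \<le> M" and "e > 0"
  obtains g where "g \<in> left_combinations {n. n \<noteq> 1} (exc_P a)"
    "integrable lborel (\<lambda>t. wnorm t (f t - g t))" "(LINT t|lborel. wnorm t (f t - g t)) < e"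
proof -
  define h where "h t = (1 / (q t)\<^sup>2) *\<^sub>R f t" for t
  have [measurable]: "q \<in> borel_measurable borel" by (rule poly_growth_measurable[OF poly_growth_q])
  have hm [measurable]: "h \<in> borel_measurable borel" unfolding h_def by measurable
  have M0: "M \<ge> 0" using M[of 0] norm_ge_zero order_trans by blast
  have hb: "norm (h t) \<le> M" for t
  proof -
    have "(q t)\<^sup>2 \<ge> 1" using q_ge[of t] by (intro one_le_power) linarith
    then have "1 / (q t)\<^sup>2 \<le> 1" by (simp add: divide_simps)
    then have "1 / (q t)\<^sup>2 * norm (f t) \<le> 1 * M" using M[of t] by (intro mult_mono) auto
    then show ?thesis by (simp add: h_def)
  qed
  have "poly_growth (\<lambda>t. (q t) ^ 4 * (w11 t + w22 t))" by (intro poly_growth_intros)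
  then obtain C where C: "C \<ge> 0" "\<And>t. \<bar>(q t) ^ 4 * (w11 t + w22 t) * exp (- (t\<^sup>2))\<bar> \<le> C * exp (- (t\<^sup>2) / 2)"
    using poly_growth_gauss_bound by blast
  \<comment> \<open>Each real coordinate contributes less than \<open>\<delta>\<close>, scaled by
    \<open>C\<close>; using \<open>C + 1\<close> keeps the quotient defined when
    \<open>C = 0\<close> and the final inequality strict.\<close>
  define \<delta> where "\<delta> = e / ((C + 1) * real DIM(complex^2^2))"
  have "\<delta> > 0" unfolding \<delta>_def using C(1) \<open>e > 0\<close> by (intro divide_pos_pos mult_pos_pos) auto
  have "gauss_approximable (\<lambda>t. h t \<bullet> b)" if "b \<in> Basis" for b
  proof (rule gauss_approximable_bounded_measurable)
    show "(\<lambda>t. h t \<bullet> b) \<in> borel_measurable borel" by measurable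
    show "\<bar>h t \<bullet> b\<bar> \<le> M" for t using Basis_le_norm[OF that, of "h t"] hb[of t] by linarith
  qed
  then have "\<forall>b\<in>Basis. \<exists>p::real poly. integrable lborel (\<lambda>t. (h t \<bullet> b - poly p t)\<^sup>2 * exp (- (t\<^sup>2) / 2)) \<and>
     (LINT t|lborel. (h t \<bullet> b - poly p t)\<^sup>2 * exp (- (t\<^sup>2) / 2)) < \<delta>"
    unfolding gauss_approximable_def using \<open>\<delta> > 0\<close> by blast
  from bchoice[OF this] obtain r :: "complex^2^2 \<Rightarrow> real poly" where
    r: "\<And>b. b \<in> Basis \<Longrightarrow> integrable lborel (\<lambda>t. (h t \<bullet> b - poly (r b) t)\<^sup>2 * exp (- (t\<^sup>2) / 2))"
       "\<And>b. b \<in> Basis \<Longrightarrow> (LINT t|lborel. (h t \<bullet> b - poly (r b) t)\<^sup>2 * exp (- (t\<^sup>2) / 2)) < \<delta>"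
    by blast
  define g where "g t = (\<Sum>b\<in>Basis. ((q t)\<^sup>2 * poly (r b) t) *\<^sub>R b)" for t
  have g: "g \<in> left_combinations {n. n \<noteq> 1} (exc_P a)"
    unfolding g_def by (intro left_combinations_sum multiple_in_span)
  define D where "D t = (\<Sum>b\<in>Basis. C * ((h t \<bullet> b - poly (r b) t)\<^sup>2 * exp (- (t\<^sup>2) / 2)))" for t
  have le: "wnorm t (f t - g t) \<le> D t" for t
  proof -
    let ?v = "h t - (\<Sum>b\<in>Basis. poly (r b) t *\<^sub>R b)"
    have "f t - g t = (q t)\<^sup>2 *\<^sub>R ?v"
      unfolding g_def h_def by (simp add: scaleR_diff_right scaleR_sum_right)
    then have n: "(norm (f t - g t))\<^sup>2 = (q t) ^ 4 * (norm ?v)\<^sup>2"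
      by (simp add: power_mult_distrib flip: power_mult)
    have v: "?v \<bullet> b = h t \<bullet> b - poly (r b) t" if "b \<in> Basis" for b
      using that by (simp add: inner_diff_left inner_sum_left_Basis)
    have "(norm ?v)\<^sup>2 = (\<Sum>b\<in>Basis. (?v \<bullet> b)\<^sup>2)"
      unfolding power2_norm_eq_inner euclidean_inner[of ?v ?v] by (simp add: power2_eq_square)
    also have "\<dots> = (\<Sum>b\<in>Basis. (h t \<bullet> b - poly (r b) t)\<^sup>2)"
      by (intro sum.cong refl) (simp only: v)
    finally have nv: "(norm ?v)\<^sup>2 = (\<Sum>b\<in>Basis. (h t \<bullet> b - poly (r b) t)\<^sup>2)" .
    have "wnorm t (f t - g t) \<le> ((q t) ^ 4 * (w11 t + w22 t) * exp (- (t\<^sup>2))) * (norm ?v)\<^sup>2"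
      using wnorm_le[of t "f t - g t"] unfolding n by (simp add: ac_simps)
    also have "\<dots> \<le> (C * exp (- (t\<^sup>2) / 2)) * (norm ?v)\<^sup>2"
      using C(2)[of t] by (intro mult_right_mono) auto
    also have "\<dots> = D t" unfolding nv D_def by (simp add: sum_distrib_left ac_simps)
    finally show ?thesis .
  qed
  have intD: "integrable lborel D"
    unfolding D_def by (intro Bochner_Integration.integrable_sum integrable_mult_right r)
  have int: "integrable lborel (\<lambda>t. wnorm t (f t - g t))"
  proof (rule Bochner_Integration.integrable_bound[OF intD])
    have "(\<lambda>t. f t - g t) \<in> borel_measurable borel"
      using matrix_growth_measurable[OF left_combinations_growth[OF g]] f by simp
    then show "(\<lambda>t. wnorm t (f t - g t)) \<in> borel_measurable lborel"
      using wnorm_measurable[of "\<lambda>t. f t - g t"] by simp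
    have "norm (wnorm t (f t - g t)) \<le> norm (D t)" for t
      using le[of t] wnorm_nonneg[of t "f t - g t"] by simp
    then show "AE t in lborel. norm (wnorm t (f t - g t)) \<le> norm (D t)" by (intro AE_I2)
  qed
  have "(LINT t|lborel. wnorm t (f t - g t)) \<le> (LINT t|lborel. D t)"
    by (rule integral_mono[OF int intD le])
  also have "\<dots> = (\<Sum>b\<in>Basis. C * (LINT t|lborel. (h t \<bullet> b - poly (r b) t)\<^sup>2 * exp (- (t\<^sup>2) / 2)))"
    unfolding D_def by (subst Bochner_Integration.integral_sum; intro integrable_mult_right r(1) sum.cong refl integral_mult_right_zero)
  also have "\<dots> \<le> (\<Sum>b\<in>(Basis :: (complex^2^2) set). C * \<delta>)"
    by (intro sum_mono mult_left_mono[OF _ C(1)] less_imp_le[OF r(2)])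
  also have "\<dots> = real DIM(complex^2^2) * (C * \<delta>)" by simp
  also have "\<dots> < real DIM(complex^2^2) * ((C + 1) * \<delta>)"
    using \<open>\<delta> > 0\<close> by (intro mult_strict_left_mono mult_strict_right_mono) auto
  also have "\<dots> = e" unfolding \<delta>_def using C(1) by (simp add: field_simps)
  finally show ?thesis by (rule that[OF g int])
qed

text \<open>The cut-off error equals the integrand of \<open>f\<close> or 0 at each point and is
  eventually 0 there, so dominated convergence applies.\<close>

lemma truncation:
  assumes f: "f \<in> L2 (exc_W a)" and "e > 0"
  obtains M where "integrable lborel (\<lambda>t. wnorm t (f t - (if norm (f t) \<le> M then f t else 0)))"
    "(LINT t|lborel. wnorm t (f t - (if norm (f t) \<le> M then f t else 0))) < e"
proof -
  have [measurable]: "f \<in> borel_measurable borel" and int: "integrable lborel (\<lambda>t. wnorm t (f t))"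
    using f by (simp_all add: L2_def wnorm_def)
  define F where "F n t = wnorm t (f t - (if norm (f t) \<le> real n then f t else 0))" for n t
  have w0: "wnorm t 0 = 0" for t by (simp add: wnorm_eq cform_def)
  have meas: "F n \<in> borel_measurable borel" for n
    unfolding F_def by (rule wnorm_measurable) measurable
  have bound: "norm (F n t) \<le> wnorm t (f t)" for n t
    using wnorm_nonneg[of t "f t"] by (simp add: F_def w0)
  have intF: "integrable lborel (F n)" for n
    by (rule Bochner_Integration.integrable_bound[OF int])
       (use meas in simp, intro AE_I2 order_trans[OF bound], simp)
  have lim: "(\<lambda>n. F n t) \<longlonglongrightarrow> 0" for t
  proof -
    obtain N where "norm (f t) \<le> real N" using real_arch_simple by blast
    then have "\<forall>\<^sub>F n in sequentially. F n t = 0"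
      by (intro eventually_sequentiallyI[of N]) (simp add: F_def w0)
    then show ?thesis by (rule tendsto_eventually)
  qed
  have "(\<lambda>n. LINT t|lborel. F n t) \<longlonglongrightarrow> (LINT t::real|lborel. (0::real))"
  proof (rule integral_dominated_convergence[OF _ _ int])
    show "AE t in lborel. (\<lambda>n. F n t) \<longlonglongrightarrow> 0" using lim by simp
    show "AE t in lborel. norm (F n t) \<le> wnorm t (f t)" for n by (intro AE_I2 bound)
  qed (use meas in simp_all)
  then have "\<forall>\<^sub>F n in sequentially. (LINT t|lborel. F n t) < e"
    using \<open>e > 0\<close> by (intro order_tendstoD(2)) auto
  then obtain n where "(LINT t|lborel. F n t) < e"
    using eventually_happens'[OF sequentially_bot] by blast
  then show ?thesis using intF[of n] unfolding F_def[abs_def] by (rule that[rotated])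
qed

lemma L2_dense_exc_P: "L2_dense (exc_W a) (left_combinations {n. n \<noteq> 1} (exc_P a))"
  unfolding L2_dense_def
proof (intro conjI ballI allI impI subsetI)
  show "g \<in> L2 (exc_W a)" if "g \<in> left_combinations {n. n \<noteq> 1} (exc_P a)" for g
    by (rule matrix_growth_L2[OF left_combinations_growth[OF that]])
  fix f and \<epsilon> :: real
  assume f: "f \<in> L2 (exc_W a)" and "\<epsilon> > 0"
  have fm [measurable]: "f \<in> borel_measurable borel" using f by (simp add: L2_def)
  \<comment> \<open>The squared error is at most twice the sum of two errors below \<open>e\<close>,
    and \<open>L2_norm\<close> takes a square root.\<close>
  define e where "e = \<epsilon>\<^sup>2 / 4"
  have "e > 0" using \<open>\<epsilon> > 0\<close> by (simp add: e_def)
  obtain M where M: "integrable lborel (\<lambda>t. wnorm t (f t - (if norm (f t) \<le> M then f t else 0)))"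
    "(LINT t|lborel. wnorm t (f t - (if norm (f t) \<le> M then f t else 0))) < e"
    using truncation[OF f \<open>e > 0\<close>] by blast
  define fM where "fM t = (if norm (f t) \<le> M then f t else 0)" for t
  have fMm: "fM \<in> borel_measurable borel" unfolding fM_def by measurable
  \<comment> \<open>The level \<open>M\<close> may be negative as far as \<open>truncation\<close>
    tells, and then \<open>fM\<close> is zero.\<close>
  have "norm (fM t) \<le> max M 0" for t by (simp add: fM_def le_max_iff_disj)
  from bounded_approximation[OF fMm this \<open>e > 0\<close>] obtain g where
    g: "g \<in> left_combinations {n. n \<noteq> 1} (exc_P a)"
    "integrable lborel (\<lambda>t. wnorm t (fM t - g t))" "(LINT t|lborel. wnorm t (fM t - g t)) < e"
    by blast
  note M = M[folded fM_def]
  have le: "wnorm t (f t - g t) \<le> 2 * wnorm t (f t - fM t) + 2 * wnorm t (fM t - g t)" for t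
    using wnorm_add_le[of t "f t - fM t" "fM t - g t"] by simp
  have int2: "integrable lborel (\<lambda>t. 2 * wnorm t (f t - fM t) + 2 * wnorm t (fM t - g t))"
    by (intro Bochner_Integration.integrable_add integrable_mult_right M g)
  have int: "integrable lborel (\<lambda>t. wnorm t (f t - g t))"
  proof (rule Bochner_Integration.integrable_bound[OF int2])
    have "(\<lambda>t. f t - g t) \<in> borel_measurable borel"
      using matrix_growth_measurable[OF left_combinations_growth[OF g(1)]] fm by simp
    then show "(\<lambda>t. wnorm t (f t - g t)) \<in> borel_measurable lborel"
      using wnorm_measurable[of "\<lambda>t. f t - g t"] by simp
    have "norm (wnorm t (f t - g t)) \<le> norm (2 * wnorm t (f t - fM t) + 2 * wnorm t (fM t - g t))" for t
      using le[of t] wnorm_nonneg[of t "f t - g t"] by simp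
    then show "AE t in lborel. norm (wnorm t (f t - g t))
        \<le> norm (2 * wnorm t (f t - fM t) + 2 * wnorm t (fM t - g t))" by (intro AE_I2)
  qed
  have "(LINT t|lborel. wnorm t (f t - g t))
      \<le> (LINT t|lborel. 2 * wnorm t (f t - fM t) + 2 * wnorm t (fM t - g t))"
    by (rule integral_mono[OF int int2 le])
  also have "\<dots> = 2 * (LINT t|lborel. wnorm t (f t - fM t)) + 2 * (LINT t|lborel. wnorm t (fM t - g t))"
    using M(1) g(2) by simp
  also have "\<dots> < \<epsilon>\<^sup>2" using M(2) g(3) by (simp add: e_def)
  finally have "L2_norm (exc_W a) (\<lambda>t. f t - g t) < \<epsilon>"
    unfolding L2_norm_def wnorm_def[symmetric] using \<open>\<epsilon> > 0\<close> by (intro real_less_lsqrt) auto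
  with g(1) show "\<exists>g\<in>left_combinations {n. n \<noteq> 1} (exc_P a). L2_norm (exc_W a) (\<lambda>t. f t - g t) < \<epsilon>"
    by blast
qed

end

theorem theorem12:
  fixes a :: real
  assumes "a\<^sup>2 > 2"
  shows "weight_matrix (exc_W a)
    \<and> orthogonal_family (exc_W a) {n. n \<noteq> 1} (exc_P a)
    \<and> (\<forall>n. n \<noteq> 1 \<longrightarrow>
         has_matrix_inner (exc_W a) (exc_P a n) (exc_P a n)
           (((real n - 1) / (2 * (a\<^sup>2 - 2))) *\<^sub>R
             (mat22 1 0 0 (- 2 / (a\<^sup>2 - 2)) ** norm_sq (signed_weight a (xi a)) (hermite_P a n))))
    \<and> (\<forall>n. has_matrix_inner (signed_weight a (xi a)) (hermite_P a n) (hermite_P a n)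
              (norm_sq (signed_weight a (xi a)) (hermite_P a n))
          \<and> norm_sq (signed_weight a (xi a)) (hermite_P a n) =
              (sqrt pi * 2 ^ n * fact n) *\<^sub>R
                mat22 (xi a + a\<^sup>2 * (real n + 1) / 2) 0
                      0 (xi a * (xi a + a\<^sup>2 * real n / 2)))
    \<and> L2_dense (exc_W a) (left_combinations {n. n \<noteq> 1} (exc_P a))"
proof -
  interpret exceptional_weight a by unfold_locales fact
  have norm: "norm_sq (signed_weight a (xi a)) (hermite_P a n) = mat22 (norm1 n) 0 0 (norm2 n)" for n
    using signed_matrix_inner[of n] unfolding norm_sq_def has_matrix_inner_def
    by (rule has_bochner_integral_integral_eq)
  have "orthogonal_family (exc_W a) {n. n \<noteq> 1} (exc_P a)"
    unfolding orthogonal_family_def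
  proof (intro ballI impI)
    fix n m :: nat assume "n \<noteq> m"
    then show "has_matrix_inner (exc_W a) (exc_P a n) (exc_P a m) 0"
      using exceptional_matrix_inner[of n m] by simp
  qed
  moreover have "has_matrix_inner (exc_W a) (exc_P a n) (exc_P a n)
           (((real n - 1) / (2 * (a\<^sup>2 - 2))) *\<^sub>R
             (mat22 1 0 0 (- 2 / (a\<^sup>2 - 2)) ** norm_sq (signed_weight a (xi a)) (hermite_P a n)))" for n
  proof -
    have "((real n - 1) / (2 * k)) *\<^sub>R (mat22 1 0 0 (- 2 / k) ** mat22 (norm1 n) 0 0 (norm2 n)) =
        mat22 ((real n - 1) / (2 * k) * norm1 n) 0 0 (- (real n - 1) / k\<^sup>2 * norm2 n)"
      unfolding mat22_simps
      by (intro arg_cong4[where f = mat22]) (simp_all add: divide_simps power2_eq_square algebra_simps)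
    then show ?thesis
      using exceptional_matrix_inner[of n n] unfolding norm k_def[symmetric] by simp
  qed
  moreover have "mat22 (norm1 n) 0 0 (norm2 n) = (sqrt pi * 2 ^ n * fact n) *\<^sub>R
                mat22 (xi a + a\<^sup>2 * (real n + 1) / 2) 0
                      0 (xi a * (xi a + a\<^sup>2 * real n / 2))" for n
    by (simp add: mat22_scaleR norm1_def norm2_def hermite_norm_def xi_def)
  ultimately show ?thesis
    using weight_matrix_exc_W signed_matrix_inner L2_dense_exc_P unfolding norm by blast
qed

end
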